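(* Let $n\ge 4$, let $T_n$ be the set of all transpositions of the symmetric group $S_n$, and let $D'$ be the $(n-1)$-dimensional irreducible representation of $S_n$ corresponding to the partition $(n-1,1)$. Then $$\kappa_{S_n}(T_n,D')>\kappa_{S_n}(T_n)=\frac{2}{\sqrt{n-1}} .$$
   Context: The representation $D'$ can be realized as the restriction of the permutation representation of $S_n$ on $\mathbb{C}^n$ (with $\pi e_k=e_{\pi(k)}$ and the standard Hermitian inner product) to the invariant subspace of vectors orthogonal to $\sum_{k=1}^n e_k$. For a finite group $G$, let $G^*_0$ be the set of all (not necessarily finite-dimensional) unitary representations $(R,V)$ of $G$ on a nonzero complex Hilbert space $V$ having no nonzero invariant vector. For a generating set $Q$ of $G$ and $(R,V)\in G_0^*$, the Kazhdan constant associated with $(Q,R)$ is $$\kappa_G(Q,R):=\inf_{v\in V:\ \|v\|=1}\ \max_{q\in Q}\|R(q)v-v\|,$$ and the Kazhdan constant of $Q$ is $$\kappa_G(Q):=\inf_{R\in G_0^*}\kappa_G(Q,R).$$ *)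

theory Defs
  imports
    Complex_Main
    "HOL-Algebra.Sym_Groups"
    "HOL-Algebra.Group_Action"
    "HOL-Algebra.Module"
    "HOL-Algebra.Algebraic_Closure_Type"
begin

section \<open>Hilbert spaces as records\<close>

text \<open>
  A complex Hilbert space is a module over the field of complex numbers with an inner product,
  on an explicit carrier. Carriers are needed because the Kazhdan constant is an infimum over
  Hilbert spaces of varying dimension. The fields \<open>mult\<close> and \<open>one\<close>, which the record type
  \<open>module\<close> inherits from \<open>ring\<close>, play no role. The inner product is linear in its first argument.
\<close>

record 'v hilbert = "(complex, 'v) module" +
  ip :: "'v \<Rightarrow> 'v \<Rightarrow> complex"

definition hnorm :: "('v, 'm) hilbert_scheme \<Rightarrow> 'v \<Rightarrow> real" where
  "hnorm V v = sqrt (Re (ip V v v))"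

locale hilbert_space = module "ring_of_type_algebra :: complex ring" V
  for V :: "('v, 'm) hilbert_scheme" (structure) +
  assumes ip_add_left:
      "\<lbrakk>x \<in> carrier V; y \<in> carrier V; z \<in> carrier V\<rbrakk>
        \<Longrightarrow> ip V (x \<oplus>\<^bsub>V\<^esub> y) z = ip V x z + ip V y z"
    and ip_smult_left:
      "\<lbrakk>x \<in> carrier V; y \<in> carrier V\<rbrakk> \<Longrightarrow> ip V (a \<odot>\<^bsub>V\<^esub> x) y = a * ip V x y"
    and ip_cnj:
      "\<lbrakk>x \<in> carrier V; y \<in> carrier V\<rbrakk> \<Longrightarrow> ip V y x = cnj (ip V x y)"
    and ip_pos:
      "\<lbrakk>x \<in> carrier V; x \<noteq> \<zero>\<^bsub>V\<^esub>\<rbrakk> \<Longrightarrow> Re (ip V x x) > 0"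
    and complete:
      "\<lbrakk>range s \<subseteq> carrier V;
        \<forall>\<epsilon>>0. \<exists>N. \<forall>i\<ge>N. \<forall>j\<ge>N. hnorm V (s i \<ominus>\<^bsub>V\<^esub> s j) < \<epsilon>\<rbrakk>
        \<Longrightarrow> \<exists>L\<in>carrier V. (\<lambda>i. hnorm V (s i \<ominus>\<^bsub>V\<^esub> L)) \<longlonglongrightarrow> 0"


section \<open>Unitary representations and Kazhdan constants\<close>

text \<open>
  A \<open>group_action\<close> is a homomorphism into the bijections of the carrier; a bijective linear
  map preserving the inner product is a unitary operator.
\<close>

locale unitary_rep = group_action G "carrier V" R + hilbert_space V
  for G :: "('g, 'b) monoid_scheme" (structure)
    and V :: "('v, 'm) hilbert_scheme" (structure)
    and R :: "'g \<Rightarrow> 'v \<Rightarrow> 'v" +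
  assumes rep_add:
      "\<lbrakk>g \<in> carrier G; x \<in> carrier V; y \<in> carrier V\<rbrakk>
        \<Longrightarrow> R g (x \<oplus>\<^bsub>V\<^esub> y) = R g x \<oplus>\<^bsub>V\<^esub> R g y"
    and rep_smult:
      "\<lbrakk>g \<in> carrier G; x \<in> carrier V\<rbrakk> \<Longrightarrow> R g (a \<odot>\<^bsub>V\<^esub> x) = a \<odot>\<^bsub>V\<^esub> R g x"
    and rep_ip:
      "\<lbrakk>g \<in> carrier G; x \<in> carrier V; y \<in> carrier V\<rbrakk> \<Longrightarrow> ip V (R g x) (R g y) = ip V x y"

definition nontrivial_reps ::
    "('g, 'b) monoid_scheme \<Rightarrow> ('v hilbert \<times> ('g \<Rightarrow> 'v \<Rightarrow> 'v)) set" where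
  "nontrivial_reps G =
    {(V, R). unitary_rep G V R \<and> carrier V \<noteq> {\<zero>\<^bsub>V\<^esub>} \<and>
       (\<forall>v\<in>carrier V. (\<forall>g\<in>carrier G. R g v = v) \<longrightarrow> v = \<zero>\<^bsub>V\<^esub>)}"

definition kazhdan_const_rep ::
    "'g set \<Rightarrow> 'v hilbert \<times> ('g \<Rightarrow> 'v \<Rightarrow> 'v) \<Rightarrow> real" where
  "kazhdan_const_rep Q = (\<lambda>(V, R).
    INF v\<in>{v \<in> carrier V. hnorm V v = 1}. MAX q\<in>Q. hnorm V (R q v \<ominus>\<^bsub>V\<^esub> v))"

text \<open>
  A term cannot quantify over types, so the Kazhdan constant takes as an argument the type
  \<open>'v\<close> of vectors: the infimum is over all Hilbert spaces whose underlying set is a subset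
  of \<open>'v\<close>. If \<open>'v\<close> is too small to carry any representation without invariant vectors (for
  instance finite), the infimum is over the empty set and has no meaning; statements about it
  should be polymorphic in \<open>'v\<close>, subject only to a lower bound on the cardinality of \<open>'v\<close>,
  such as an injection from \<open>nat \<Rightarrow> complex\<close>, the type containing the spaces $\mathbb{C}^n$ below.
\<close>

definition kazhdan_const ::
    "'v itself \<Rightarrow> ('g, 'b) monoid_scheme \<Rightarrow> 'g set \<Rightarrow> real" where
  "kazhdan_const (_ :: 'v itself) G Q =
    (INF VR\<in>(nontrivial_reps G :: ('v hilbert \<times> ('g \<Rightarrow> 'v \<Rightarrow> 'v)) set). kazhdan_const_rep Q VR)"


section \<open>The symmetric group and its representation $D'$\<close>

definition transpositions :: "nat \<Rightarrow> (nat \<Rightarrow> nat) set" where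
  "transpositions n = {transpose a b | a b. a \<in> {1..n} \<and> b \<in> {1..n} \<and> a \<noteq> b}"

text \<open>$\mathbb{C}^n$, as the functions supported on \<open>{1..n}\<close>.\<close>

definition complex_space :: "nat \<Rightarrow> (nat \<Rightarrow> complex) hilbert" where
  "complex_space n =
    \<lparr>carrier = {v. \<forall>k. k \<notin> {1..n} \<longrightarrow> v k = 0},
     monoid.mult = undefined, one = undefined,
     ring.zero = (\<lambda>_. 0), add = (\<lambda>v w k. v k + w k),
     module.smult = (\<lambda>a v k. a * v k),
     ip = (\<lambda>v w. \<Sum>k=1..n. v k * cnj (w k))\<rparr>"

definition basis_vec :: "nat \<Rightarrow> nat \<Rightarrow> complex" where
  "basis_vec k = (\<lambda>i. if i = k then 1 else 0)"

definition perm_op :: "(nat \<Rightarrow> nat) \<Rightarrow> (nat \<Rightarrow> complex) \<Rightarrow> nat \<Rightarrow> complex" where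
  "perm_op p v = v \<circ> inv' p"

lemma perm_op_basis_vec: "bij p \<Longrightarrow> perm_op p (basis_vec k) = basis_vec (p k)"
  by (auto simp: perm_op_def basis_vec_def fun_eq_iff bij_is_inj bij_is_surj surj_f_inv_f)

definition std_space :: "nat \<Rightarrow> (nat \<Rightarrow> complex) hilbert" where
  "std_space n = (complex_space n)
    \<lparr>carrier := {v \<in> carrier (complex_space n).
                  ip (complex_space n) v (\<lambda>i. \<Sum>k=1..n. basis_vec k i) = 0}\<rparr>"

text \<open>
  The representation of partition $(n-1,1)$: the permutation representation restricted to the
  orthogonal complement of $\sum_k e_k$.
\<close>

definition std_rep ::
    "nat \<Rightarrow> (nat \<Rightarrow> complex) hilbert \<times> ((nat \<Rightarrow> nat) \<Rightarrow> (nat \<Rightarrow> complex) \<Rightarrow> nat \<Rightarrow> complex)" where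
  "std_rep n = (std_space n, \<lambda>p. restrict (perm_op p) (carrier (std_space n)))"

end

theory Submission
  imports Defs "HOL-Library.Nat_Bijection"
begin

text \<open>
  The Kazhdan constant is $2/\sqrt{n-1}$ because the random transposition walk has a spectral gap.
  Suppose that a unitary representation of $S_n$ has no nonzero invariant vector. Then every vector
  $v$ satisfies
  $\sum_{t \in T_n} (\|v\|^2 - \mathrm{Re} \langle tv, v\rangle) \ge n \|v\|^2$,
  that is, $\sum_t \|tv - v\|^2 \ge 2n\|v\|^2$, so that one of the $n(n-1)/2$ transpositions moves a
  unit vector by at least $2/\sqrt{n-1}$. The inequality is \<open>energy_gap\<close>, and its proof uses
  neither characters nor a decomposition into irreducibles. It is an induction on the set $A$ of
  letters that are permuted. The inequality for the sets $A \setminus \{k\}$, summed over $k$, gives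
  the one for $A$ once the projections $P_k$ onto the vectors fixed by the stabilizer of $k$ satisfy
  $\sum_k \|P_k v\|^2 \le \frac{m}{m-1} \|v\|^2$, where $m = |A|$ and $v$ has no invariant
  component. This holds because $\sum_k P_k$, on such vectors, is $\frac{m}{m-1}$ times a projection
  (\<open>sum_norm_stabilizer_averages_le\<close>).

  Equality requires a vector that every transposition moves equally far. In $D'$ the transposition
  $(i\,j)$ moves $x$ by $\sqrt 2\, |x_i - x_j|$, so one would need equidistant coordinates; these exist
  when the coordinates are taken in $\mathbb{C}^n$ instead of $\mathbb{C}$. Hence the value is attained
  in a multiple of $D'$, by the matrix whose rows are the vertices of a centred regular simplex
  (\<open>exists_rep_kazhdan_const_le\<close>).

  In $D'$ itself the coordinates $x_1, \dots, x_n$ are points of a plane, where four points cannot be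
  equidistant. Quantitatively, if $\sum_k x_k = 0$ and $\sum_k |x_k|^2 = 1$ then
  $\sum_{k,l} |x_k - x_l|^2 = 2n$, while $\sum_{k,l} |x_k - x_l|^4 \ge 6$ because the Gram matrix of
  planar points has rank at most 2. So some $|x_k - x_l|^2$ is at least $3/n$, the constant of $D'$ is
  at least $\sqrt{6/n}$, and this exceeds $2/\sqrt{n-1}$ exactly when $n > 3$.
\<close>

(* Otherwise the simplifier turns {1..n} into {Suc 0..n}, to which facts about {1..n} do not apply. *)
declare One_nat_def [simp del]

section \<open>Inner products in a Hilbert space\<close>

lemma carrier_ring_of_type_algebra [simp]: "a \<in> carrier ring_of_type_algebra"
  by (simp add: ring_of_type_algebra_def)

context hilbert_space
begin

lemma diff_add:
  assumes "x \<in> carrier V" "y \<in> carrier V"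
  shows "(x \<ominus>\<^bsub>V\<^esub> y) \<oplus>\<^bsub>V\<^esub> y = x"
  using assms by (simp add: M.minus_eq M.a_assoc M.l_neg)

lemma ip_diff_left:
  assumes "x \<in> carrier V" "y \<in> carrier V" "z \<in> carrier V"
  shows "ip V (x \<ominus>\<^bsub>V\<^esub> y) z = ip V x z - ip V y z"
proof -
  have "ip V x z = ip V (x \<ominus>\<^bsub>V\<^esub> y) z + ip V y z"
    using assms ip_add_left[of "x \<ominus>\<^bsub>V\<^esub> y" y z] by (simp add: diff_add)
  then show ?thesis by simp
qed

lemma ip_zero_left:
  assumes "y \<in> carrier V"
  shows "ip V \<zero>\<^bsub>V\<^esub> y = 0"
  using ip_add_left[of "\<zero>\<^bsub>V\<^esub>" "\<zero>\<^bsub>V\<^esub>" y] assms by simp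

lemma ip_diff_right:
  assumes "x \<in> carrier V" "y \<in> carrier V" "z \<in> carrier V"
  shows "ip V z (x \<ominus>\<^bsub>V\<^esub> y) = ip V z x - ip V z y"
  using assms ip_cnj[of x z] ip_cnj[of y z] ip_cnj[of "x \<ominus>\<^bsub>V\<^esub> y" z]
  by (simp add: ip_diff_left)

lemma ip_smult_right:
  assumes "x \<in> carrier V" "y \<in> carrier V"
  shows "ip V x (a \<odot>\<^bsub>V\<^esub> y) = cnj a * ip V x y"
  using assms ip_cnj[of y x] ip_cnj[of "a \<odot>\<^bsub>V\<^esub> y" x] by (simp add: ip_smult_left)

lemma ip_finsum_left:
  assumes "finite I" "\<And>i. i \<in> I \<Longrightarrow> f i \<in> carrier V" "y \<in> carrier V"
  shows "ip V (finsum V f I) y = (\<Sum>i\<in>I. ip V (f i) y)"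
  using assms
proof (induction I rule: finite_induct)
  case empty
  then show ?case by (simp add: ip_zero_left)
next
  case (insert i I)
  then have "f \<in> I \<rightarrow> carrier V" "f i \<in> carrier V" by auto
  then show ?case using insert by (simp add: M.finsum_insert ip_add_left)
qed

lemma ip_finsum_right:
  assumes "finite I" "\<And>i. i \<in> I \<Longrightarrow> f i \<in> carrier V" "y \<in> carrier V"
  shows "ip V y (finsum V f I) = (\<Sum>i\<in>I. ip V y (f i))"
proof -
  have c: "finsum V f I \<in> carrier V" using assms by (intro M.finsum_closed) auto
  have "ip V y (finsum V f I) = cnj (ip V (finsum V f I) y)"
    by (rule ip_cnj[OF c assms(3)])
  also have "\<dots> = (\<Sum>i\<in>I. cnj (ip V (f i) y))"
    using assms by (simp add: ip_finsum_left)
  also have "\<dots> = (\<Sum>i\<in>I. ip V y (f i))"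
    using assms by (intro sum.cong) (auto simp: ip_cnj[symmetric])
  finally show ?thesis .
qed

lemma ip_self_nonneg: "x \<in> carrier V \<Longrightarrow> Re (ip V x x) \<ge> 0"
  using ip_pos[of x] ip_zero_left[of "\<zero>\<^bsub>V\<^esub>"] by (cases "x = \<zero>\<^bsub>V\<^esub>") auto

lemma Re_ip_commute: "\<lbrakk>x \<in> carrier V; y \<in> carrier V\<rbrakk> \<Longrightarrow> Re (ip V y x) = Re (ip V x y)"
  using ip_cnj[of x y] by simp

lemma hnorm_power2: "x \<in> carrier V \<Longrightarrow> (hnorm V x)\<^sup>2 = Re (ip V x x)"
  by (simp add: hnorm_def ip_self_nonneg)

lemma ip_self_diff:
  assumes "x \<in> carrier V" "y \<in> carrier V"
  shows "Re (ip V (x \<ominus>\<^bsub>V\<^esub> y) (x \<ominus>\<^bsub>V\<^esub> y)) = Re (ip V x x) - 2 * Re (ip V x y) + Re (ip V y y)"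
  using assms by (simp add: ip_diff_left ip_diff_right Re_ip_commute[of x y])

text \<open>
  Sums of vectors over permutations are compared through their inner products with all vectors,
  which turns them into sums of complex numbers that can be reindexed.
\<close>

lemma eq_by_ip:
  assumes "x \<in> carrier V" "y \<in> carrier V"
    and "\<And>z. z \<in> carrier V \<Longrightarrow> ip V x z = ip V y z"
  shows "x = y"
proof -
  have "ip V (x \<ominus>\<^bsub>V\<^esub> y) (x \<ominus>\<^bsub>V\<^esub> y) = 0"
    using assms by (simp add: ip_diff_left)
  then have "x \<ominus>\<^bsub>V\<^esub> y = \<zero>\<^bsub>V\<^esub>"
    using ip_pos[of "x \<ominus>\<^bsub>V\<^esub> y"] assms by auto
  then show ?thesis using diff_add[OF assms(1,2)] assms(2) by simp
qed

lemma exists_unit_vector: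
  assumes "carrier V \<noteq> {\<zero>\<^bsub>V\<^esub>}"
  shows "\<exists>v\<in>carrier V. hnorm V v = 1"
proof -
  obtain x where x: "x \<in> carrier V" "x \<noteq> \<zero>\<^bsub>V\<^esub>" using assms M.zero_closed by blast
  define r where "r = hnorm V x"
  have r: "r > 0" using ip_pos[OF x] by (simp add: r_def hnorm_def)
  define y where "y = complex_of_real (1 / r) \<odot>\<^bsub>V\<^esub> x"
  have y: "y \<in> carrier V" using x by (simp add: y_def)
  have "ip V y y = complex_of_real (1 / r) * (complex_of_real (1 / r) * ip V x x)"
    unfolding y_def using x(1) by (subst ip_smult_left, simp, simp, subst ip_smult_right) auto
  then have "Re (ip V y y) = (1 / r) * ((1 / r) * Re (ip V x x))" by simp
  also have "Re (ip V x x) = r\<^sup>2" using x(1) by (simp add: r_def hnorm_power2)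
  also have "(1 / r) * ((1 / r) * r\<^sup>2) = 1" using r by (simp add: power2_eq_square)
  finally have "hnorm V y = 1" by (simp add: hnorm_def)
  then show ?thesis using y by blast
qed

end

section \<open>Sums over the permutations of a set\<close>

locale sym_unitary_rep = unitary_rep "sym_group n" V R
  for n :: nat and V :: "('v, 'm) hilbert_scheme" (structure)
    and R :: "(nat \<Rightarrow> nat) \<Rightarrow> 'v \<Rightarrow> 'v"
begin

lemma perm_mem: "A \<subseteq> {1..n} \<Longrightarrow> p permutes A \<Longrightarrow> p \<in> carrier (sym_group n)"
  by (auto simp: sym_group_carrier intro: permutes_subset)

lemma transpose_mem:
  "i \<in> {1..n} \<Longrightarrow> j \<in> {1..n} \<Longrightarrow> transpose i j \<in> carrier (sym_group n)"
  by (simp add: sym_group_carrier permutes_swap_id)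

lemma rep_closed:
  "g \<in> carrier (sym_group n) \<Longrightarrow> x \<in> carrier V \<Longrightarrow> R g x \<in> carrier V"
  using element_image by blast

lemma rep_comp:
  "\<lbrakk>g \<in> carrier (sym_group n); h \<in> carrier (sym_group n); x \<in> carrier V\<rbrakk>
    \<Longrightarrow> R g (R h x) = R (g \<circ> h) x"
  using composition_rule[of x g h] by (simp add: sym_group_mult)

lemma rep_id: "x \<in> carrier V \<Longrightarrow> R id x = x"
  using id_eq_one by (metis restrict_apply' sym_group_one)

lemma rep_diff:
  assumes "g \<in> carrier (sym_group n)" "x \<in> carrier V" "y \<in> carrier V"
  shows "R g (x \<ominus>\<^bsub>V\<^esub> y) = R g x \<ominus>\<^bsub>V\<^esub> R g y"
proof -
  have "R g x = R g ((x \<ominus>\<^bsub>V\<^esub> y) \<oplus>\<^bsub>V\<^esub> y)"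
    using assms by (simp add: M.minus_eq M.a_assoc M.l_neg)
  also have "\<dots> = R g (x \<ominus>\<^bsub>V\<^esub> y) \<oplus>\<^bsub>V\<^esub> R g y"
    using assms by (simp add: rep_add)
  finally show ?thesis
    using assms by (simp add: rep_closed M.minus_eq M.a_assoc M.r_neg)
qed

lemma rep_ip_inv:
  assumes "g \<in> carrier (sym_group n)" "x \<in> carrier V" "y \<in> carrier V"
  shows "ip V (R g x) y = ip V x (R (inv' g) y)"
proof -
  have g: "inv' g \<in> carrier (sym_group n)" 
    using assms(1) by (simp add: sym_group_carrier permutes_inv)
  have "inv' g \<circ> g = id" using assms(1) by (simp add: sym_group_carrier permutes_inv_o)
  then show ?thesis
    using rep_ip[OF g rep_closed[OF assms(1,2)] assms(3)] assms g by (simp add: rep_comp rep_id)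
qed

lemma rep_transpose_ip:
  assumes "i \<in> {1..n}" "j \<in> {1..n}" "x \<in> carrier V" "y \<in> carrier V"
  shows "ip V (R (transpose i j) x) y = ip V x (R (transpose i j) y)"
  using rep_ip_inv[OF transpose_mem[OF assms(1,2)] assms(3,4)] by simp

text \<open>
  This is $|A|!$ times the orthogonal projection onto the vectors fixed by all permutations of $A$.
  Leaving out the factor keeps scalars away from the reindexing arguments.
\<close>

definition perm_sum :: "nat set \<Rightarrow> 'v \<Rightarrow> 'v" where
  "perm_sum A x = finsum V (\<lambda>p. R p x) {p. p permutes A}"

lemma finite_perms: "A \<subseteq> {1..n} \<Longrightarrow> finite {p. p permutes A}"
  by (intro finite_permutations) (auto intro: finite_subset)

lemma perm_sum_closed: "A \<subseteq> {1..n} \<Longrightarrow> x \<in> carrier V \<Longrightarrow> perm_sum A x \<in> carrier V"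
  unfolding perm_sum_def by (intro M.finsum_closed) (auto intro: rep_closed perm_mem)

lemma ip_perm_sum:
  assumes "A \<subseteq> {1..n}" "x \<in> carrier V" "y \<in> carrier V"
  shows "ip V (perm_sum A x) y = (\<Sum>p | p permutes A. ip V (R p x) y)"
  unfolding perm_sum_def using assms
  by (intro ip_finsum_left finite_perms) (auto intro: rep_closed perm_mem)

lemma ip_perm_sum_right:
  assumes "A \<subseteq> {1..n}" "x \<in> carrier V" "y \<in> carrier V"
  shows "ip V y (perm_sum A x) = (\<Sum>p | p permutes A. ip V y (R p x))"
  unfolding perm_sum_def using assms
  by (intro ip_finsum_right finite_perms) (auto intro: rep_closed perm_mem)

lemma perm_sum_adjoint:
  assumes "A \<subseteq> {1..n}" "x \<in> carrier V" "y \<in> carrier V"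
  shows "ip V (perm_sum A x) y = ip V x (perm_sum A y)"
proof -
  have "ip V (perm_sum A x) y = (\<Sum>p | p permutes A. ip V x (R (inv' p) y))"
    using assms by (simp add: ip_perm_sum rep_ip_inv perm_mem)
  also have "\<dots> = (\<Sum>p | p permutes A. ip V x (R p y))"
    by (rule sum.reindex_bij_betw[OF bij_betw_byWitness[where f' = inv']])
       (auto simp: permutes_inv permutes_inv_inv)
  finally show ?thesis using assms by (simp add: ip_perm_sum_right)
qed

lemma rep_perm_sum:
  assumes A: "A \<subseteq> {1..n}" and q: "q permutes A" and x: "x \<in> carrier V"
  shows "R q (perm_sum A x) = perm_sum A x"
proof (rule eq_by_ip)
  show "R q (perm_sum A x) \<in> carrier V" "perm_sum A x \<in> carrier V"
    using assms by (auto intro: rep_closed perm_mem perm_sum_closed)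
next
  fix y assume y: "y \<in> carrier V"
  have q': "inv' q permutes A" using q by (rule permutes_inv)
  have "ip V (R q (perm_sum A x)) y = (\<Sum>p | p permutes A. ip V (R p x) (R (inv' q) y))"
    using assms y q' by (simp add: rep_ip_inv ip_perm_sum perm_sum_closed perm_mem rep_closed)
  also have "\<dots> = (\<Sum>p | p permutes A. ip V (R (q \<circ> p) x) y)"
    using assms y q' by (intro sum.cong) (auto simp: rep_ip_inv[symmetric] rep_comp rep_closed perm_mem)
  also have "\<dots> = (\<Sum>p | p permutes A. ip V (R p x) y)"
    by (rule sum.reindex_bij_betw[where h = "\<lambda>p. q \<circ> p" and g = "\<lambda>p. ip V (R p x) y",
          OF bij_betw_byWitness[where f' = "\<lambda>p. inv' q \<circ> p"]])
       (use permutes_compose[OF _ q] permutes_compose[OF _ q'] in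
         \<open>auto simp: o_assoc permutes_inv_o[OF q]\<close>)
  also have "\<dots> = ip V (perm_sum A x) y" using A x y by (simp add: ip_perm_sum)
  finally show "ip V (R q (perm_sum A x)) y = ip V (perm_sum A x) y" .
qed

lemma ip_perm_sum_invariant:
  assumes A: "A \<subseteq> {1..n}" and x: "x \<in> carrier V" and y: "y \<in> carrier V"
    and inv: "\<And>p. p permutes A \<Longrightarrow> R p y = y"
  shows "ip V (perm_sum A x) y = fact (card A) * ip V x y"
proof -
  have "finite A" using A finite_subset by blast
  moreover have "ip V (perm_sum A x) y = (\<Sum>p | p permutes A. ip V x y)"
    using assms by (simp add: perm_sum_adjoint ip_perm_sum_right)
  ultimately show ?thesis by (simp add: card_permutations[OF refl])
qed

text \<open>
  Up to the factor, \<open>perm_sum A\<close> is idempotent and self-adjoint.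
\<close>

lemma ip_perm_sum_self:
  assumes A: "A \<subseteq> {1..n}" and x: "x \<in> carrier V"
  shows "ip V (perm_sum A x) (perm_sum A x) = fact (card A) * ip V (perm_sum A x) x"
  using ip_perm_sum_invariant[OF A x perm_sum_closed[OF A x] rep_perm_sum[OF A _ x]]
  by (simp add: perm_sum_adjoint[OF A x x])

text \<open>
  The transpositions $(k\,l)$ with $l \in A$ represent the left cosets of the stabilizer of $k$ in
  the group of permutations of $A$.
\<close>

lemma perm_sum_coset:
  assumes A: "A \<subseteq> {1..n}" and k: "k \<in> A" and x: "x \<in> carrier V" and y: "y \<in> carrier V"
  shows "(\<Sum>l\<in>A. ip V (R (transpose k l) (perm_sum (A - {k}) x)) y) = ip V (perm_sum A x) y"
proof -
  have fin: "finite A" using A finite_subset by blast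
  have A': "insert k (A - {k}) = A" using k by auto
  have "ip V (perm_sum A x) y = (\<Sum>p | p permutes (insert k (A - {k})). ip V (R p x) y)"
    unfolding A' using A x y by (rule ip_perm_sum)
  also have "\<dots> = (\<Sum>l\<in>A. \<Sum>p | p permutes (A - {k}). ip V (R (transpose k l \<circ> p) x) y)"
    using fin by (subst sum_over_permutations_insert) (simp_all add: A' del: insert_Diff_single)
  also have "\<dots> = (\<Sum>l\<in>A. ip V (R (transpose k l) (perm_sum (A - {k}) x)) y)"
  proof (rule sum.cong[OF refl])
    fix l assume l: "l \<in> A"
    have t: "transpose k l \<in> carrier (sym_group n)" using l k A by (auto intro: transpose_mem)
    have B: "A - {k} \<subseteq> {1..n}" using A by auto
    have y': "R (transpose k l) y \<in> carrier V" using t y by (rule rep_closed)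
    have "ip V (R (transpose k l) (perm_sum (A - {k}) x)) y
        = ip V (perm_sum (A - {k}) x) (R (transpose k l) y)"
      using l k A x y B by (intro rep_transpose_ip perm_sum_closed) auto
    also have "\<dots> = (\<Sum>p | p permutes (A - {k}). ip V (R (transpose k l \<circ> p) x) y)"
      unfolding ip_perm_sum[OF B x y']
    proof (rule sum.cong[OF refl])
      fix p assume "p \<in> {p. p permutes (A - {k})}"
      then have p: "p \<in> carrier (sym_group n)" using B by (auto intro: perm_mem)
      show "ip V (R p x) (R (transpose k l) y) = ip V (R (transpose k l \<circ> p) x) y"
        using rep_transpose_ip[of k l "R p x" y] l k A x y t p
        by (auto simp: rep_comp rep_closed subset_iff)
    qed
    finally show "(\<Sum>p | p permutes (A - {k}). ip V (R (transpose k l \<circ> p) x) y)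
        = ip V (R (transpose k l) (perm_sum (A - {k}) x)) y" by simp
  qed
  finally show ?thesis by simp
qed

text \<open>
  Conjugation with $(j\,k)$ carries the stabilizer of $k$ to the stabilizer of $j$.
\<close>

lemma rep_perm_sum_conj:
  assumes A: "A \<subseteq> {1..n}" and j: "j \<in> A" and k: "k \<in> A" and x: "x \<in> carrier V"
  shows "R (transpose j k) (perm_sum (A - {k}) x) = perm_sum (A - {j}) (R (transpose j k) x)"
proof (rule eq_by_ip)
  have B: "A - {k} \<subseteq> {1..n}" "A - {j} \<subseteq> {1..n}" using A by auto
  have t: "transpose j k \<in> carrier (sym_group n)" using j k A by (auto intro: transpose_mem)
  show "R (transpose j k) (perm_sum (A - {k}) x) \<in> carrier V"
       "perm_sum (A - {j}) (R (transpose j k) x) \<in> carrier V"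
    using B t x by (auto intro: rep_closed perm_sum_closed)
  fix y assume y: "y \<in> carrier V"
  let ?c = "\<lambda>p. transpose j k \<circ> p \<circ> transpose j k"
  have "ip V (R (transpose j k) (perm_sum (A - {k}) x)) y
      = ip V (perm_sum (A - {k}) x) (R (transpose j k) y)"
    using j k A x y B by (intro rep_transpose_ip perm_sum_closed) auto
  also have "\<dots> = (\<Sum>p | p permutes (A - {k}). ip V (R (transpose j k) (R p x)) y)"
    unfolding ip_perm_sum[OF B(1) x rep_closed[OF t y]]
    using j k A B x y
    by (intro sum.cong refl rep_transpose_ip[symmetric]) (auto intro: rep_closed perm_mem)
  also have "\<dots> = (\<Sum>p | p permutes (A - {k}). ip V (R (?c p) (R (transpose j k) x)) y)"
  proof (rule sum.cong[OF refl])
    fix p assume "p \<in> {p. p permutes (A - {k})}"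
    then have p: "p \<in> carrier (sym_group n)" using B by (auto intro: perm_mem)
    have c: "?c p \<in> carrier (sym_group n)"
      using p t by (simp add: sym_group_carrier permutes_compose)
    show "ip V (R (transpose j k) (R p x)) y = ip V (R (?c p) (R (transpose j k) x)) y"
      using rep_comp[OF t p x] rep_comp[OF c t x] by (simp add: comp_assoc)
  qed
  also have "\<dots> = (\<Sum>p | p permutes (A - {j}). ip V (R p (R (transpose j k) x)) y)"
  proof (rule sum.reindex_bij_betw[OF bij_betw_byWitness[where f' = ?c]])
    have img: "transpose j k ` (A - {k}) = A - {j}" "transpose j k ` (A - {j}) = A - {k}"
      using j k by (auto simp: transpose_def image_iff split: if_splits)
    have conj: "?c p permutes (transpose j k ` B)" if "p permutes B" for p B
    proof -
      have "bij (?c p)" using permutes_bij[OF that] by (intro bij_comp) auto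
      moreover have "?c p x = x" if "x \<notin> transpose j k ` B" for x
      proof -
        have "transpose j k x \<notin> B" using that by (metis image_eqI transpose_involutory)
        then show ?thesis using \<open>p permutes B\<close> by (simp add: permutes_not_in)
      qed
      ultimately show ?thesis by (simp add: permutes_def bij_iff)
    qed
    show "?c ` {p. p permutes (A - {k})} \<subseteq> {p. p permutes (A - {j})}"
      using conj[of _ "A - {k}"] by (auto simp: img)
    show "?c ` {p. p permutes (A - {j})} \<subseteq> {p. p permutes (A - {k})}"
      using conj[of _ "A - {j}"] by (auto simp: img)
  qed (auto simp: fun_eq_iff)
  also have "\<dots> = ip V (perm_sum (A - {j}) (R (transpose j k) x)) y"
    using B x y t by (simp add: ip_perm_sum rep_closed)
  finally show "ip V (R (transpose j k) (perm_sum (A - {k}) x)) y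
      = ip V (perm_sum (A - {j}) (R (transpose j k) x)) y" .
qed

end

section \<open>The spectral gap of the transpositions\<close>

context sym_unitary_rep
begin

lemma rep_transpose_perm_sum:
  assumes "A \<subseteq> {1..n}" "i \<in> A" "j \<in> A" "x \<in> carrier V"
  shows "R (transpose i j) (perm_sum A x) = perm_sum A x"
  using assms by (intro rep_perm_sum) (auto intro: permutes_swap_id)

lemma ip_invariant_perm_sum:
  assumes "A \<subseteq> {1..n}" "x \<in> carrier V" "y \<in> carrier V"
    and "\<And>p. p permutes A \<Longrightarrow> R p y = y"
  shows "ip V y (perm_sum A x) = fact (card A) * ip V y x"
  using ip_perm_sum_invariant[OF assms] ip_cnj[of "perm_sum A x" y] ip_cnj[of x y]
    assms(1-3) by (simp add: perm_sum_closed)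

text \<open>
  Write $m = |A|$ and let $w_k$ be the sum of $pv$ over the permutations $p$ of $A \setminus \{k\}$.
  Fix $j \ne k$. For $l \ne j$ the transposition $(k\,l)$ fixes $w_j$, so
  $\langle w_j, (k\,l) w_k\rangle = \langle w_j, w_k\rangle$. The vectors $(k\,l) w_k$ add up to the sum
  over all permutations of $A$, which vanishes; therefore
  $(m-1) \langle w_j, w_k\rangle = - \langle w_j, (k\,j) w_k\rangle$. The right-hand side is a multiple of
  $\langle (j\,k) w_j, v\rangle$, and its sum over $k \ne j$ is determined in the same way, by the
  vanishing of $\sum_l (j\,l) w_j$. As a result
  $(m-1) \sum_{k \ne j} \langle w_j, w_k\rangle = \|w_j\|^2$, so that
  $\|\sum_k w_k\|^2 = \frac{m}{m-1} \sum_k \|w_k\|^2$. Since $\langle w_k, v\rangle$ is a multiple of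
  $\|w_k\|^2$, the Cauchy-Schwarz inequality for $\sum_k w_k$ and $v$ is the claim.
\<close>

lemma sum_norm_stabilizer_averages_le:
  assumes A: "A \<subseteq> {1..n}" and card: "card A \<ge> 2" and v: "v \<in> carrier V"
    and zero: "perm_sum A v = \<zero>\<^bsub>V\<^esub>"
  shows "(real (card A) - 1) * (\<Sum>k\<in>A. Re (ip V (perm_sum (A - {k}) v) (perm_sum (A - {k}) v)))
    \<le> real (card A) * (fact (card A - 1))\<^sup>2 * Re (ip V v v)"
proof -
  define m where "m = real (card A)"
  define f :: real where "f = fact (card A - 1)"
  define w where "w k = perm_sum (A - {k}) v" for k
  define S where "S = (\<Sum>k\<in>A. Re (ip V (w k) (w k)))"
  have fin: "finite A" using A finite_subset by blast
  have m: "m \<ge> 2" using card by (simp add: m_def)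
  have f: "f > 0" by (simp add: f_def)
  have cfact_minus: "fact (card (A - {j})) = complex_of_real f" if "j \<in> A" for j
    using that by (simp add: f_def)
  have AS: "A - {k} \<subseteq> {1..n}" for k using A by auto
  have w: "w k \<in> carrier V" for k
    unfolding w_def using AS v by (rule perm_sum_closed)
  have tw: "R (transpose i j) (w k) \<in> carrier V" if "i \<in> A" "j \<in> A" for i j k
    using that A w by (intro rep_closed transpose_mem) auto
  have coset: "(\<Sum>l\<in>A. ip V (R (transpose k l) (w k)) y) = 0" if "k \<in> A" "y \<in> carrier V" for k y
    using perm_sum_coset[OF A that(1) v that(2)] that by (simp add: w_def zero ip_zero_left)
  have w_v: "Re (ip V (w j) (w j)) = f * Re (ip V (w j) v)" if "j \<in> A" for j
    using ip_perm_sum_self[OF AS v, of j] unfolding w_def[symmetric] cfact_minus[OF that] by simp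
  have off_diag: "(m - 1) * Re (ip V (w j) (w k)) = - f * Re (ip V (R (transpose j k) (w j)) v)"
    if jk: "j \<in> A" "k \<in> A" "j \<noteq> k" for j k
  proof -
    have moved: "ip V (R (transpose k l) (w k)) (w j) = ip V (w k) (w j)" if l: "l \<in> A - {j}" for l
    proof -
      have "ip V (R (transpose k l) (w k)) (w j) = ip V (w k) (R (transpose k l) (w j))"
        using A jk l w by (intro rep_transpose_ip) auto
      also have "R (transpose k l) (w j) = w j"
        unfolding w_def using AS jk l v by (intro rep_transpose_perm_sum) auto
      finally show ?thesis .
    qed
    have "0 = ip V (R (transpose k j) (w k)) (w j) + (\<Sum>l\<in>A-{j}. ip V (R (transpose k l) (w k)) (w j))"
      using coset[OF jk(2) w, of j] fin jk by (simp add: sum.remove)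
    also have "(\<Sum>l\<in>A-{j}. ip V (R (transpose k l) (w k)) (w j)) = of_real (m - 1) * ip V (w k) (w j)"
      using moved jk card by (simp add: m_def of_nat_diff)
    also have "ip V (R (transpose k j) (w k)) (w j) = ip V (R (transpose j k) v) (w j) * f"
    proof -
      have t: "transpose j k \<in> carrier (sym_group n)" using A jk by (auto intro: transpose_mem)
      have "R (transpose k j) (w k) = perm_sum (A - {j}) (R (transpose j k) v)"
        unfolding w_def by (subst transpose_commute) (rule rep_perm_sum_conj[OF A jk(1,2) v])
      moreover have "ip V (perm_sum (A - {j}) (R (transpose j k) v)) (w j)
          = fact (card (A - {j})) * ip V (R (transpose j k) v) (w j)"
        using AS v t w by (intro ip_perm_sum_invariant) (auto simp: w_def rep_perm_sum intro: rep_closed)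
      ultimately show ?thesis using cfact_minus[OF jk(1)] by simp
    qed
    also have "ip V (R (transpose j k) v) (w j) = ip V v (R (transpose j k) (w j))"
      using A jk w v by (intro rep_transpose_ip) auto
    finally have "0 = Re (ip V v (R (transpose j k) (w j)) * f + of_real (m - 1) * ip V (w k) (w j))"
      by simp
    then show ?thesis
      using Re_ip_commute[OF w w, of j k] Re_ip_commute[OF v tw[OF jk(1,2)], of j]
      by (simp add: algebra_simps eq_neg_iff_add_eq_0)
  qed
  have row: "(m - 1) * (\<Sum>k\<in>A. Re (ip V (w j) (w k))) = m * Re (ip V (w j) (w j))" if j: "j \<in> A" for j
  proof -
    have "(m - 1) * (\<Sum>k\<in>A-{j}. Re (ip V (w j) (w k)))
        = - f * (\<Sum>k\<in>A-{j}. Re (ip V (R (transpose j k) (w j)) v))"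
      unfolding sum_distrib_left using off_diag j by (intro sum.cong) auto
    also have "(\<Sum>k\<in>A-{j}. Re (ip V (R (transpose j k) (w j)) v)) = - Re (ip V (w j) v)"
    proof -
      have "0 = Re (\<Sum>l\<in>A. ip V (R (transpose j l) (w j)) v)" using coset[OF j v] by simp
      also have "\<dots> = Re (ip V (w j) v) + (\<Sum>k\<in>A-{j}. Re (ip V (R (transpose j k) (w j)) v))"
        using fin j w by (simp add: sum.remove rep_id)
      finally show ?thesis by simp
    qed
    finally have "(m - 1) * (\<Sum>k\<in>A-{j}. Re (ip V (w j) (w k))) = Re (ip V (w j) (w j))"
      using w_v[OF j] by simp
    then show ?thesis using fin j by (simp add: sum.remove algebra_simps)
  qed
  define W where "W = finsum V w A"
  have W: "W \<in> carrier V" unfolding W_def using w by (intro M.finsum_closed) auto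
  have Wv: "f * Re (ip V W v) = S"
    unfolding W_def S_def using fin w v by (simp add: ip_finsum_left sum_distrib_left w_v)
  have WW: "(m - 1) * Re (ip V W W) = m * S"
  proof -
    have "ip V W W = (\<Sum>j\<in>A. ip V (w j) W)"
      unfolding W_def[THEN arg_cong[where f = "\<lambda>x. ip V x W"]]
      using fin w W by (simp add: ip_finsum_left)
    also have "\<dots> = (\<Sum>j\<in>A. \<Sum>k\<in>A. ip V (w j) (w k))"
      unfolding W_def using fin w by (simp add: ip_finsum_right)
    finally have "(m - 1) * Re (ip V W W) = (\<Sum>j\<in>A. (m - 1) * (\<Sum>k\<in>A. Re (ip V (w j) (w k))))"
      by (simp add: sum_distrib_left)
    then show ?thesis unfolding S_def sum_distrib_left[of m] using row by simp
  qed
  \<comment> \<open>For this \<open>c\<close>, the vector \<open>c W\<close> is the orthogonal projection of \<open>v\<close> onto the line of \<open>W\<close>.\<close>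
  define c where "c = (m - 1) / (m * f)"
  have "0 \<le> Re (ip V (v \<ominus>\<^bsub>V\<^esub> (complex_of_real c \<odot>\<^bsub>V\<^esub> W)) (v \<ominus>\<^bsub>V\<^esub> (complex_of_real c \<odot>\<^bsub>V\<^esub> W)))"
    using v W by (intro ip_self_nonneg) simp
  also have "\<dots> = Re (ip V v v) - 2 * (c * Re (ip V W v)) + c * (c * Re (ip V W W))"
    using v W by (simp add: ip_self_diff ip_smult_left ip_smult_right Re_ip_commute[of W v])
  also have "Re (ip V W v) = S / f" using Wv f by (simp add: field_simps)
  also have "Re (ip V W W) = m * S / (m - 1)" using WW m by (simp add: field_simps)
  also have "Re (ip V v v) - 2 * (c * (S / f)) + c * (c * (m * S / (m - 1)))
      = Re (ip V v v) - (m - 1) * S / (m * f\<^sup>2)"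
    using m f by (simp add: c_def field_simps power2_eq_square)
  finally have "(m - 1) * S \<le> m * f\<^sup>2 * Re (ip V v v)"
    using m f by (simp add: field_simps)
  then show ?thesis by (simp add: m_def S_def f_def w_def)
qed

text \<open>
  The pairs are ordered, so each transposition counts twice; the pairs with $i = j$ contribute 0.
  Up to this factor 2 it is the quadratic form of $\sum_t (1 - t)$ over the transpositions of $A$.
\<close>

definition energy :: "nat set \<Rightarrow> 'v \<Rightarrow> real" where
  "energy A v = (\<Sum>i\<in>A. \<Sum>j\<in>A. Re (ip V v v) - Re (ip V (R (transpose i j) v) v))"

text \<open>
  A pair of distinct letters survives the deletion of one letter in $|A| - 2$ cases.
\<close>

lemma sum_energy_delete:
  assumes A: "A \<subseteq> {1..n}" and v: "v \<in> carrier V"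
  shows "(\<Sum>k\<in>A. energy (A - {k}) v) = (real (card A) - 2) * energy A v"
proof -
  have fin: "finite A" using A finite_subset by blast
  define e where "e i j = Re (ip V v v) - Re (ip V (R (transpose i j) v) v)" for i j
  have diag: "e i i = 0" for i using v by (simp add: e_def rep_id)
  have "(\<Sum>k\<in>A. energy (A - {k}) v) = (\<Sum>k\<in>A. \<Sum>i\<in>A. \<Sum>j\<in>A. if i \<noteq> k \<and> j \<noteq> k then e i j else 0)"
  proof (rule sum.cong[OF refl])
    fix k
    have "energy (A - {k}) v = (\<Sum>i\<in>A-{k}. \<Sum>j\<in>A-{k}. if i \<noteq> k \<and> j \<noteq> k then e i j else 0)"
      unfolding energy_def e_def by (intro sum.cong) auto
    also have "\<dots> = (\<Sum>i\<in>A. \<Sum>j\<in>A. if i \<noteq> k \<and> j \<noteq> k then e i j else 0)"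
      using fin by (intro sum.mono_neutral_cong_left) (auto intro!: sum.mono_neutral_left)
    finally show "energy (A - {k}) v = \<dots>" .
  qed
  also have "\<dots> = (\<Sum>i\<in>A. \<Sum>k\<in>A. \<Sum>j\<in>A. if i \<noteq> k \<and> j \<noteq> k then e i j else 0)"
    by (rule sum.swap)
  also have "\<dots> = (\<Sum>i\<in>A. \<Sum>j\<in>A. \<Sum>k\<in>A. if i \<noteq> k \<and> j \<noteq> k then e i j else 0)"
    by (intro sum.cong refl sum.swap)
  also have "\<dots> = (\<Sum>i\<in>A. \<Sum>j\<in>A. (real (card A) - 2) * e i j)"
  proof (intro sum.cong refl)
    fix i j assume ij: "i \<in> A" "j \<in> A"
    show "(\<Sum>k\<in>A. if i \<noteq> k \<and> j \<noteq> k then e i j else 0) = (real (card A) - 2) * e i j"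
    proof (cases "i = j")
      case False
      have "(\<Sum>k\<in>A. if i \<noteq> k \<and> j \<noteq> k then e i j else 0) = (\<Sum>k\<in>A-{i,j}. e i j)"
        using fin by (intro sum.mono_neutral_cong_right) auto
      also have "\<dots> = real (card (A - {i,j})) * e i j" by simp
      also have "card (A - {i,j}) = card A - 2"
        using fin ij False by (simp add: card_Diff_subset)
      also have "real (card A - 2) = real (card A) - 2"
        using card_mono[OF fin, of "{i,j}"] ij False by (simp add: of_nat_diff)
      finally show ?thesis .
    next
      case True
      then have "e i j = 0" using diag by simp
      then show ?thesis by (simp add: sum.neutral)
    qed
  qed
  also have "\<dots> = (real (card A) - 2) * energy A v"
    by (simp add: energy_def e_def sum_distrib_left)
  finally show ?thesis .
qed

text \<open>
  Summing the hypotheses over $k$ bounds $(|A| - 2)$ times the energy, which says nothing about sets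
  of two letters. There the transposition acts as $-1$ on $v$, since $v + tv = 0$.
\<close>

lemma energy_gap_of_perm_sum_zero:
  assumes A: "A \<subseteq> {1..n}" and v: "v \<in> carrier V" and zero: "perm_sum A v = \<zero>\<^bsub>V\<^esub>"
    and IH: "\<And>k. k \<in> A \<Longrightarrow> energy (A - {k}) v \<ge> 2 * (real (card A) - 1) *
      (Re (ip V v v) - Re (ip V (perm_sum (A - {k}) v) (perm_sum (A - {k}) v)) / (fact (card A - 1))\<^sup>2)"
  shows "energy A v \<ge> 2 * real (card A) * Re (ip V v v)"
proof -
  have fin: "finite A" using A finite_subset by blast
  define m where "m = real (card A)"
  have sing: "perm_sum {k} v = v" if "k \<in> {1..n}" for k
    using that v by (simp add: perm_sum_def rep_id)
  consider "A = {}" | "card A = 1" | "card A = 2" | "card A \<ge> 3"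
    using fin by (cases "card A") (auto, linarith)
  then show ?thesis
  proof cases
    case 1
    then show ?thesis by (simp add: energy_def)
  next
    case 2
    then obtain k where "A = {k}" by (auto simp: card_1_singleton_iff One_nat_def)
    then have "v = \<zero>\<^bsub>V\<^esub>" using sing A zero by auto
    then show ?thesis using \<open>A = {k}\<close> v by (simp add: energy_def ip_zero_left rep_id)
  next
    case 3
    then obtain a b where ab: "A = {a, b}" "a \<noteq> b" by (auto simp: card_2_iff)
    have "(\<Sum>l\<in>A. ip V (R (transpose a l) (perm_sum (A - {a}) v)) v) = 0"
      using perm_sum_coset[OF A _ v v, of a] v
      by (simp only: zero ip_zero_left) (simp add: ab)
    moreover have "A - {a} = {b}" using ab by auto
    ultimately have "ip V v v + ip V (R (transpose a b) v) v = 0"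
      using ab v A by (simp add: sing rep_id)
    then have "Re (ip V (R (transpose a b) v) v) = - Re (ip V v v)"
      by (simp add: complex_eq_iff)
    then show ?thesis using ab v by (simp add: energy_def rep_id transpose_commute[of b a])
  next
    case 4
    define F :: real where "F = (fact (card A - 1))\<^sup>2"
    have F: "F > 0" by (simp add: F_def)
    define S where "S = (\<Sum>k\<in>A. Re (ip V (perm_sum (A - {k}) v) (perm_sum (A - {k}) v)))"
    have m: "m \<ge> 3" using 4 by (simp add: m_def)
    have S: "(m - 1) * S \<le> m * F * Re (ip V v v)"
      using sum_norm_stabilizer_averages_le[OF A _ v zero] 4 by (simp add: m_def S_def F_def)
    have "(m - 2) * energy A v = (\<Sum>k\<in>A. energy (A - {k}) v)"
      using sum_energy_delete[OF A v] by (simp add: m_def)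
    also have "\<dots> \<ge> (\<Sum>k\<in>A. 2 * (m - 1) * (Re (ip V v v)
        - Re (ip V (perm_sum (A - {k}) v) (perm_sum (A - {k}) v)) / F))"
      unfolding m_def F_def by (intro sum_mono IH)
    also have "(\<Sum>k\<in>A. 2 * (m - 1) * (Re (ip V v v)
        - Re (ip V (perm_sum (A - {k}) v) (perm_sum (A - {k}) v)) / F))
        = 2 * (m - 1) * (m * Re (ip V v v) - S / F)"
      by (simp add: m_def S_def sum_subtractf sum_divide_distrib flip: sum_distrib_left)
    finally have "(m - 2) * energy A v \<ge> 2 * (m - 1) * (m * Re (ip V v v) - S / F)" .
    moreover have "(m - 1) * (S / F) \<le> m * Re (ip V v v)"
      using S F by (simp add: pos_divide_le_eq mult.commute mult.left_commute)
    moreover have "2 * (m - 1) * (m * e - q) = (m - 2) * (2 * m * e) + 2 * (m * e - (m - 1) * q)"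
      for e q :: real by (simp add: algebra_simps)
    ultimately have "(m - 2) * energy A v \<ge> (m - 2) * (2 * m * Re (ip V v v))"
      by simp
    then show ?thesis using m by (simp add: m_def)
  qed
qed

text \<open>
  The projection of $v$ onto the invariant vectors can be subtracted: this leaves the energy
  unchanged and lowers $\|v\|^2$ by the squared norm of the projection. The bound is sharp, with
  equality for instance on the standard representation of the permutations of $A$.
\<close>

lemma energy_gap:
  assumes "A \<subseteq> {1..n}" "v \<in> carrier V"
  shows "energy A v \<ge> 2 * real (card A) *
    (Re (ip V v v) - Re (ip V (perm_sum A v) (perm_sum A v)) / (fact (card A))\<^sup>2)"
  using assms
proof (induction "card A" arbitrary: A v rule: less_induct)
  case less
  note A = \<open>A \<subseteq> {1..n}\<close> and v = \<open>v \<in> carrier V\<close>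
  have fin: "finite A" using A finite_subset by blast
  define f :: real where "f = fact (card A)"
  have f: "f > 0" by (simp add: f_def)
  define s where "s = perm_sum A v"
  have s: "s \<in> carrier V" unfolding s_def using A v by (rule perm_sum_closed)
  define u where "u = complex_of_real (1 / f) \<odot>\<^bsub>V\<^esub> s"
  have u: "u \<in> carrier V" using s by (simp add: u_def)
  have u_inv: "R p u = u" if "p permutes A" for p
    using that A v s by (simp add: u_def rep_smult perm_mem) (simp add: s_def rep_perm_sum)
  define v' where "v' = v \<ominus>\<^bsub>V\<^esub> u"
  have v': "v' \<in> carrier V" using v u by (simp add: v'_def)
  have zero: "perm_sum A v' = \<zero>\<^bsub>V\<^esub>"
  proof (rule eq_by_ip)
    fix z assume z: "z \<in> carrier V"
    have "ip V u (perm_sum A z) = f * ip V u z"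
      using ip_invariant_perm_sum[OF A z u u_inv] by (simp add: f_def)
    also have "\<dots> = ip V s z" using f s z by (simp add: u_def ip_smult_left)
    also have "\<dots> = ip V v (perm_sum A z)" using A v z by (simp add: s_def perm_sum_adjoint)
    finally show "ip V (perm_sum A v') z = ip V \<zero>\<^bsub>V\<^esub> z"
      using A v v' u z
      by (simp add: perm_sum_adjoint ip_zero_left perm_sum_closed) 
         (simp add: v'_def ip_diff_left perm_sum_closed)
  qed (use A v' in \<open>auto intro: perm_sum_closed\<close>)
  have "energy A v' = energy A v"
    unfolding energy_def
  proof (intro sum.cong refl)
    fix i j assume ij: "i \<in> A" "j \<in> A"
    have t: "transpose i j \<in> carrier (sym_group n)" using A ij by (auto intro: transpose_mem)
    have tu: "R (transpose i j) u = u" using ij by (intro u_inv permutes_swap_id)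
    have "ip V (R (transpose i j) v) u = ip V v u"
      using rep_ip[OF t v u] tu by simp
    moreover have "R (transpose i j) v' = R (transpose i j) v \<ominus>\<^bsub>V\<^esub> u"
      using t v u by (simp add: v'_def rep_diff tu)
    ultimately show "Re (ip V v' v') - Re (ip V (R (transpose i j) v') v')
        = Re (ip V v v) - Re (ip V (R (transpose i j) v) v)"
      using v u t by (simp add: v'_def ip_diff_left ip_diff_right rep_closed)
  qed
  moreover have "energy A v' \<ge> 2 * real (card A) * Re (ip V v' v')"
  proof (rule energy_gap_of_perm_sum_zero[OF A v' zero])
    fix k assume k: "k \<in> A"
    have "card A > 0" using k fin by (auto simp: card_gt_0_iff)
    then show "2 * (real (card A) - 1) * (Re (ip V v' v')
        - Re (ip V (perm_sum (A - {k}) v') (perm_sum (A - {k}) v')) / (fact (card A - 1))\<^sup>2)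
        \<le> energy (A - {k}) v'"
      using less.hyps[of "A - {k}" v'] A v' k by (auto simp: of_nat_diff Suc_le_eq)
  qed
  moreover have "Re (ip V v' v') = Re (ip V v v) - Re (ip V s s) / f\<^sup>2"
  proof -
    have "Re (ip V s s) = f * Re (ip V v s)"
      using ip_perm_sum_self[OF A v] Re_ip_commute[OF s v] by (simp add: s_def f_def)
    then have "Re (ip V v u) = Re (ip V s s) / f\<^sup>2"
      using v s f by (simp add: u_def ip_smult_right power2_eq_square)
    moreover have "Re (ip V u u) = Re (ip V s s) / f\<^sup>2"
      using s by (simp add: u_def ip_smult_left ip_smult_right power2_eq_square)
    ultimately show ?thesis using v u by (simp add: v'_def ip_self_diff)
  qed
  ultimately show ?case by (simp add: s_def f_def)
qed

end

section \<open>The lower bound for the Kazhdan constant\<close>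

lemma transpositions_subset: "transpositions n \<subseteq> {p. p permutes {1..n}}"
  by (auto simp: transpositions_def intro: permutes_swap_id)

lemma finite_transpositions: "finite (transpositions n)"
  using transpositions_subset by (rule finite_subset) (simp add: finite_permutations)

lemma transpositions_nonempty: "n \<ge> 2 \<Longrightarrow> transpositions n \<noteq> {}"
proof -
  assume "n \<ge> 2"
  then have "(1::nat) \<in> {1..n}" "(2::nat) \<in> {1..n}" by auto
  then have "transpose (1::nat) 2 \<in> transpositions n"
    unfolding transpositions_def by force
  then show ?thesis by blast
qed

lemma displacement_le_Max:
  assumes "i \<in> {1..n}" "j \<in> {1..n}" "i \<noteq> j"
  shows "f (transpose i j) \<le> (MAX q\<in>transpositions n. f q :: real)"
  using assms by (intro Max_ge finite_imageI finite_transpositions) (auto simp: transpositions_def)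

text \<open>
  The $n(n-1)$ ordered pairs share an energy of at least $2n$, and
  $\|tv - v\|^2 = 2 (\|v\|^2 - \mathrm{Re}\langle tv, v\rangle)$.
\<close>

lemma (in sym_unitary_rep) max_displacement_ge:
  assumes n: "n \<ge> 2" and v: "v \<in> carrier V" and unit: "hnorm V v = 1"
    and no_inv: "\<And>w. \<lbrakk>w \<in> carrier V; \<forall>g\<in>carrier (sym_group n). R g w = w\<rbrakk> \<Longrightarrow> w = \<zero>\<^bsub>V\<^esub>"
  shows "2 / sqrt (real n - 1) \<le> (MAX q\<in>transpositions n. hnorm V (R q v \<ominus>\<^bsub>V\<^esub> v))"
proof -
  define M where "M = (MAX q\<in>transpositions n. hnorm V (R q v \<ominus>\<^bsub>V\<^esub> v))"
  have vv: "Re (ip V v v) = 1" using hnorm_power2[OF v] unit by simp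
  have displ: "Re (ip V v v) - Re (ip V (R (transpose i j) v) v) \<le> M\<^sup>2 / 2"
    if ij: "i \<in> {1..n}" "j \<in> {1..n}" "i \<noteq> j" for i j
  proof -
    let ?u = "R (transpose i j) v"
    have u: "?u \<in> carrier V" using ij v by (intro rep_closed transpose_mem)
    have "hnorm V (?u \<ominus>\<^bsub>V\<^esub> v) \<le> M"
      unfolding M_def using ij by (rule displacement_le_Max)
    moreover have "0 \<le> hnorm V (?u \<ominus>\<^bsub>V\<^esub> v)" using u v by (simp add: hnorm_def ip_self_nonneg)
    ultimately have "(hnorm V (?u \<ominus>\<^bsub>V\<^esub> v))\<^sup>2 \<le> M\<^sup>2" by (intro power_mono)
    moreover have "(hnorm V (?u \<ominus>\<^bsub>V\<^esub> v))\<^sup>2 = 2 * (Re (ip V v v) - Re (ip V ?u v))"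
      using u v rep_ip[OF transpose_mem[OF ij(1,2)] v v] by (simp add: hnorm_power2 ip_self_diff)
    ultimately show ?thesis by simp
  qed
  have "perm_sum {1..n} v = \<zero>\<^bsub>V\<^esub>"
    by (rule no_inv) (auto simp: sym_group_carrier intro!: perm_sum_closed rep_perm_sum v)
  then have "2 * real n \<le> energy {1..n} v"
    using energy_gap[OF order_refl v] by (simp add: vv ip_zero_left)
  also have "\<dots> \<le> (\<Sum>i\<in>{1..n}. (real n - 1) * (M\<^sup>2 / 2))"
    unfolding energy_def
  proof (rule sum_mono)
    fix i assume i: "i \<in> {1..n}"
    have "(\<Sum>j\<in>{1..n}. Re (ip V v v) - Re (ip V (R (transpose i j) v) v))
        = (\<Sum>j\<in>{1..n}-{i}. Re (ip V v v) - Re (ip V (R (transpose i j) v) v))"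
      using i v by (simp add: sum.remove rep_id)
    also have "\<dots> \<le> (\<Sum>j\<in>{1..n}-{i}. M\<^sup>2 / 2)"
      using i by (intro sum_mono displ) auto
    also have "\<dots> = (real n - 1) * (M\<^sup>2 / 2)" using i by (simp add: of_nat_diff)
    finally show "(\<Sum>j\<in>{1..n}. Re (ip V v v) - Re (ip V (R (transpose i j) v) v))
        \<le> (real n - 1) * (M\<^sup>2 / 2)" .
  qed
  finally have "4 \<le> (real n - 1) * M\<^sup>2" using n by simp
  then have "4 / (real n - 1) \<le> M\<^sup>2" using n by (simp add: pos_divide_le_eq mult.commute)
  then have "sqrt (4 / (real n - 1)) \<le> \<bar>M\<bar>" using real_sqrt_le_mono by fastforce
  moreover have "M \<ge> 0"
  proof -
    have ij: "(1::nat) \<in> {1..n}" "(2::nat) \<in> {1..n}" using n by auto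
    have "0 \<le> hnorm V (R (transpose 1 2) v \<ominus>\<^bsub>V\<^esub> v)"
      using v ij by (simp only: hnorm_def real_sqrt_ge_0_iff) (auto intro!: ip_self_nonneg rep_closed transpose_mem)
    also have "\<dots> \<le> M" unfolding M_def using ij by (intro displacement_le_Max) auto
    finally show ?thesis .
  qed
  ultimately show ?thesis by (simp add: M_def real_sqrt_divide)
qed

lemma nontrivial_rep_max_displacement_ge:
  assumes n: "n \<ge> 2" and VR: "(V, R) \<in> nontrivial_reps (sym_group n)"
    and v: "v \<in> carrier V" "hnorm V v = 1"
  shows "2 / sqrt (real n - 1) \<le> (MAX q\<in>transpositions n. hnorm V (R q v \<ominus>\<^bsub>V\<^esub> v))"
proof -
  have "sym_unitary_rep n V R"
    using VR by (simp add: nontrivial_reps_def sym_unitary_rep_def)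
  then show ?thesis
    by (rule sym_unitary_rep.max_displacement_ge[OF _ n v]) (use VR in \<open>auto simp: nontrivial_reps_def\<close>)
qed

lemma kazhdan_const_rep_transpositions_ge:
  assumes "n \<ge> 2" and "VR \<in> nontrivial_reps (sym_group n)"
  shows "2 / sqrt (real n - 1) \<le> kazhdan_const_rep (transpositions n) VR"
proof -
  obtain V R where VR: "VR = (V, R)" by (cases VR)
  interpret unitary_rep "sym_group n" V R using assms(2) by (simp add: nontrivial_reps_def VR)
  have "{v \<in> carrier V. hnorm V v = 1} \<noteq> {}"
    using exists_unit_vector assms(2) by (auto simp: nontrivial_reps_def VR)
  then show ?thesis
    unfolding VR kazhdan_const_rep_def prod.case
    using nontrivial_rep_max_displacement_ge assms by (intro cINF_greatest) (auto simp: VR)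
qed

lemma kazhdan_const_rep_transpositions_le:
  assumes "n \<ge> 2" and "(V, R) \<in> nontrivial_reps (sym_group n)"
    and "v \<in> carrier V" "hnorm V v = 1"
  shows "kazhdan_const_rep (transpositions n) (V, R) \<le> (MAX q\<in>transpositions n. hnorm V (R q v \<ominus>\<^bsub>V\<^esub> v))"
  unfolding kazhdan_const_rep_def prod.case
  using nontrivial_rep_max_displacement_ge[OF assms(1,2)] assms(3,4)
  by (intro cINF_lower bdd_belowI2[where m = "2 / sqrt (real n - 1)"]) auto

section \<open>Spaces cut out of a coordinate space by linear equations\<close>

text \<open>
  Describing a subspace by equations makes its closedness under pointwise limits, hence its
  completeness, immediate.
\<close>

definition annihilator :: "'i set \<Rightarrow> ('i \<Rightarrow> complex) set \<Rightarrow> ('i \<Rightarrow> complex) set" where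
  "annihilator I K = {f. (\<forall>k. k \<notin> I \<longrightarrow> f k = 0) \<and> (\<forall>c\<in>K. (\<Sum>k\<in>I. f k * cnj (c k)) = 0)}"

text \<open>
  The injection \<open>e\<close> names the vectors. With \<open>e = id\<close> they are functions, and other choices
  place the same Hilbert space inside any type that is large enough.
\<close>

definition coord_space ::
    "(('i \<Rightarrow> complex) \<Rightarrow> 'v) \<Rightarrow> 'i set \<Rightarrow> ('i \<Rightarrow> complex) set \<Rightarrow> 'v hilbert" where
  "coord_space e I K =
    \<lparr>carrier = e ` annihilator I K,
     monoid.mult = undefined, one = undefined,
     ring.zero = e (\<lambda>_. 0), add = (\<lambda>x y. e (\<lambda>k. inv' e x k + inv' e y k)),
     module.smult = (\<lambda>a x. e (\<lambda>k. a * inv' e x k)),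
     ip = (\<lambda>x y. \<Sum>k\<in>I. inv' e x k * cnj (inv' e y k))\<rparr>"

lemma annihilator_zero: "(\<lambda>_. 0) \<in> annihilator I K"
  by (simp add: annihilator_def)

lemma annihilator_add:
  "f \<in> annihilator I K \<Longrightarrow> g \<in> annihilator I K \<Longrightarrow> (\<lambda>k. f k + g k) \<in> annihilator I K"
  by (simp add: annihilator_def distrib_right sum.distrib)

lemma annihilator_scale: "f \<in> annihilator I K \<Longrightarrow> (\<lambda>k. a * f k) \<in> annihilator I K"
  by (simp add: annihilator_def mult.assoc flip: sum_distrib_left)

lemma annihilator_minus: "f \<in> annihilator I K \<Longrightarrow> (\<lambda>k. - f k) \<in> annihilator I K"
  by (simp add: annihilator_def sum_negf)

lemma annihilator_limit:
  assumes "\<And>i::nat. s i \<in> annihilator I K" and lim: "\<And>k. (\<lambda>i. s i k) \<longlonglongrightarrow> f k"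
  shows "f \<in> annihilator I K"
proof -
  have "f k = 0" if "k \<notin> I" for k
    using lim[of k] that assms(1) by (simp add: annihilator_def LIMSEQ_const_iff)
  moreover have "(\<Sum>k\<in>I. f k * cnj (c k)) = 0" if "c \<in> K" for c
  proof -
    have "(\<lambda>i. \<Sum>k\<in>I. s i k * cnj (c k)) \<longlonglongrightarrow> (\<Sum>k\<in>I. f k * cnj (c k))"
      by (intro tendsto_intros lim)
    then show ?thesis using assms(1) that by (simp add: annihilator_def LIMSEQ_const_iff)
  qed
  ultimately show ?thesis by (simp add: annihilator_def)
qed

context
  fixes e :: "('i \<Rightarrow> complex) \<Rightarrow> 'v" and I :: "'i set" and K :: "('i \<Rightarrow> complex) set"
  assumes inj: "inj e"
begin

lemma coord_space_simps:
  "carrier (coord_space e I K) = e ` annihilator I K"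
  "\<zero>\<^bsub>coord_space e I K\<^esub> = e (\<lambda>_. 0)"
  "e f \<oplus>\<^bsub>coord_space e I K\<^esub> e g = e (\<lambda>k. f k + g k)"
  "a \<odot>\<^bsub>coord_space e I K\<^esub> e f = e (\<lambda>k. a * f k)"
  "ip (coord_space e I K) (e f) (e g) = (\<Sum>k\<in>I. f k * cnj (g k))"
  by (simp_all add: coord_space_def inv_f_f[OF inj])

lemma hnorm_coord_space: "hnorm (coord_space e I K) (e f) = sqrt (\<Sum>k\<in>I. (cmod (f k))\<^sup>2)"
  by (simp add: hnorm_def coord_space_simps complex_mult_cnj cmod_power2)

lemma coord_space_abelian_group: "abelian_group (coord_space e I K)"
proof (rule abelian_groupI)
  fix x assume "x \<in> carrier (coord_space e I K)"
  then obtain f where f: "f \<in> annihilator I K" "x = e f" by (auto simp: coord_space_simps)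
  have "e (\<lambda>k. - f k) \<in> carrier (coord_space e I K)"
    using annihilator_minus[OF f(1)] by (simp add: coord_space_simps)
  moreover have "e (\<lambda>k. - f k) \<oplus>\<^bsub>coord_space e I K\<^esub> x = \<zero>\<^bsub>coord_space e I K\<^esub>"
    by (simp add: f coord_space_simps)
  ultimately show "\<exists>y\<in>carrier (coord_space e I K). y \<oplus>\<^bsub>coord_space e I K\<^esub> x = \<zero>\<^bsub>coord_space e I K\<^esub>"
    by blast
qed (auto simp: coord_space_simps annihilator_zero annihilator_add add_ac)

lemma coord_space_diff:
  assumes f: "f \<in> annihilator I K" and g: "g \<in> annihilator I K"
  shows "e f \<ominus>\<^bsub>coord_space e I K\<^esub> e g = e (\<lambda>k. f k - g k)"
proof -
  interpret abelian_group "coord_space e I K" by (rule coord_space_abelian_group)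
  have "\<ominus>\<^bsub>coord_space e I K\<^esub> e g = e (\<lambda>k. - g k)"
    using g annihilator_minus[OF g] by (intro minus_equality) (auto simp: coord_space_simps)
  then show ?thesis by (simp add: a_minus_def coord_space_simps)
qed

lemma coord_space_hilbert:
  assumes fin: "finite I"
  shows "hilbert_space (coord_space e I K)"
proof (intro hilbert_space.intro hilbert_space_axioms.intro moduleI coord_space_abelian_group)
  let ?V = "coord_space e I K"
  show "cring (ring_of_type_algebra :: complex ring)" by (rule cring_from_type_algebra)
  show "Re (ip ?V x x) > 0" if x: "x \<in> carrier ?V" "x \<noteq> \<zero>\<^bsub>?V\<^esub>" for x
  proof -
    obtain f where f: "f \<in> annihilator I K" "x = e f" using x(1) by (auto simp: coord_space_simps)
    then have "f \<noteq> (\<lambda>_. 0)" using x(2) by (auto simp: coord_space_simps)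
    then obtain k where "f k \<noteq> 0" by (auto simp: fun_eq_iff)
    then have "k \<in> I" "0 < (cmod (f k))\<^sup>2" using f by (auto simp: annihilator_def)
    then have "0 < (\<Sum>k\<in>I. (cmod (f k))\<^sup>2)"
      using fin by (intro sum_pos2[of _ k]) auto
    then show ?thesis by (simp add: f coord_space_simps complex_mult_cnj cmod_power2)
  qed
  fix s :: "nat \<Rightarrow> 'v"
  assume s: "range s \<subseteq> carrier ?V"
    and cauchy: "\<forall>\<epsilon>>0. \<exists>N. \<forall>i\<ge>N. \<forall>j\<ge>N. hnorm ?V (s i \<ominus>\<^bsub>?V\<^esub> s j) < \<epsilon>"
  have "\<forall>i. \<exists>f. f \<in> annihilator I K \<and> s i = e f" using s by (auto simp: coord_space_simps)
  then obtain f where f: "\<And>i. f i \<in> annihilator I K" "\<And>i. s i = e (f i)" by metis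
  have "convergent (\<lambda>i. f i k)" for k
  proof (cases "k \<in> I")
    case True
    have "Cauchy (\<lambda>i. f i k)"
      unfolding Cauchy_def
    proof (intro allI impI)
      fix \<epsilon> :: real assume "\<epsilon> > 0"
      then obtain N where N: "\<And>i j. i \<ge> N \<Longrightarrow> j \<ge> N \<Longrightarrow> hnorm ?V (s i \<ominus>\<^bsub>?V\<^esub> s j) < \<epsilon>"
        using cauchy by blast
      have "dist (f i k) (f j k) < \<epsilon>" if "i \<ge> N" "j \<ge> N" for i j
      proof -
        have "cmod (f i k - f j k) \<le> sqrt (\<Sum>k\<in>I. (cmod (f i k - f j k))\<^sup>2)"
          using fin True by (intro real_le_rsqrt member_le_sum) auto
        also have "\<dots> < \<epsilon>"
          using N[OF that] by (simp add: f coord_space_diff hnorm_coord_space)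
        finally show ?thesis by (simp add: dist_norm)
      qed
      then show "\<exists>N. \<forall>i\<ge>N. \<forall>j\<ge>N. dist (f i k) (f j k) < \<epsilon>" by blast
    qed
    then show ?thesis by (rule Cauchy_convergent)
  next
    case False
    then show ?thesis using f(1) by (simp add: annihilator_def convergent_const)
  qed
  then have g: "(\<lambda>i. f i k) \<longlonglongrightarrow> lim (\<lambda>i. f i k)" for k by (simp only: convergent_LIMSEQ_iff)
  define g where "g k = lim (\<lambda>i. f i k)" for k
  note g = g[folded g_def]
  have gK: "g \<in> annihilator I K" by (rule annihilator_limit[of f, OF f(1) g])
  have "(\<lambda>i. sqrt (\<Sum>k\<in>I. (cmod (f i k - g k))\<^sup>2)) \<longlonglongrightarrow> sqrt (\<Sum>k\<in>I. (cmod (g k - g k))\<^sup>2)"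
    by (intro tendsto_intros g)
  then have "(\<lambda>i. hnorm ?V (s i \<ominus>\<^bsub>?V\<^esub> e g)) \<longlonglongrightarrow> 0"
    by (simp add: f gK coord_space_diff hnorm_coord_space)
  then show "\<exists>L\<in>carrier ?V. (\<lambda>i. hnorm ?V (s i \<ominus>\<^bsub>?V\<^esub> L)) \<longlonglongrightarrow> 0"
    using gK by (auto simp: coord_space_simps)
next
  let ?V = "coord_space e I K"
  fix x y z assume "x \<in> carrier ?V" "y \<in> carrier ?V" "z \<in> carrier ?V"
  then obtain f g h where "x = e f" "y = e g" "z = e h" by (auto simp: coord_space_simps)
  then show "ip ?V (x \<oplus>\<^bsub>?V\<^esub> y) z = ip ?V x z + ip ?V y z"
    by (simp add: coord_space_simps distrib_right sum.distrib)
next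
  let ?V = "coord_space e I K"
  fix x y a assume "x \<in> carrier ?V" "y \<in> carrier ?V"
  then obtain f g where "x = e f" "y = e g" by (auto simp: coord_space_simps)
  then show "ip ?V (a \<odot>\<^bsub>?V\<^esub> x) y = a * ip ?V x y" "ip ?V y x = cnj (ip ?V x y)"
    by (simp_all add: coord_space_simps sum_distrib_left mult_ac)
qed (auto simp: coord_space_simps ring_of_type_algebra_def annihilator_scale distrib_left distrib_right mult.assoc)

text \<open>
  Precomposition reverses the order of composition, so \<open>\<pi>\<close> has to be an antihomomorphism.
\<close>

lemma coord_space_unitary_rep:
  fixes G :: "('g, 'b) monoid_scheme" and \<pi> :: "'g \<Rightarrow> 'i \<Rightarrow> 'i"
  assumes "finite I" and G: "group G"
    and one: "\<pi> \<one>\<^bsub>G\<^esub> = id"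
    and mult: "\<And>g h. \<lbrakk>g \<in> carrier G; h \<in> carrier G\<rbrakk> \<Longrightarrow> \<pi> (g \<otimes>\<^bsub>G\<^esub> h) = \<pi> h \<circ> \<pi> g"
    and bij: "\<And>g. g \<in> carrier G \<Longrightarrow> bij_betw (\<pi> g) I I"
    and closed: "\<And>g f. \<lbrakk>g \<in> carrier G; f \<in> annihilator I K\<rbrakk> \<Longrightarrow> f \<circ> \<pi> g \<in> annihilator I K"
  shows "unitary_rep G (coord_space e I K)
    (\<lambda>g. \<lambda>x\<in>e ` annihilator I K. e (inv' e x \<circ> \<pi> g))"
proof -
  let ?V = "coord_space e I K"
  let ?R = "\<lambda>g. \<lambda>x\<in>e ` annihilator I K. e (inv' e x \<circ> \<pi> g)"
  interpret G: group G by (rule G)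
  have R: "?R g (e f) = e (f \<circ> \<pi> g)" if "f \<in> annihilator I K" for g f
    using that by (simp add: inv_f_f[OF inj])
  have RR: "?R g (?R h x) = ?R (g \<otimes>\<^bsub>G\<^esub> h) x"
    if "g \<in> carrier G" "h \<in> carrier G" "x \<in> e ` annihilator I K" for g h x
  proof -
    obtain f where f: "f \<in> annihilator I K" "x = e f" using \<open>x \<in> e ` annihilator I K\<close> by auto
    have "?R g (?R h x) = e (f \<circ> \<pi> h \<circ> \<pi> g)"
      unfolding f(2) R[OF f(1)] using closed[OF that(2) f(1)] by (rule R)
    also have "\<dots> = ?R (g \<otimes>\<^bsub>G\<^esub> h) x"
      unfolding f(2) R[OF f(1)] mult[OF that(1,2)] using f(1) by (simp add: o_assoc inv_f_f[OF inj])
    finally show ?thesis .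
  qed
  have R1: "?R \<one>\<^bsub>G\<^esub> x = x" if "x \<in> e ` annihilator I K" for x
    using that by (auto simp: one inv_f_f[OF inj])
  have RC: "?R g x \<in> e ` annihilator I K" if "g \<in> carrier G" "x \<in> e ` annihilator I K" for g x
    using that closed R by auto
  have Bij: "?R g \<in> Bij (e ` annihilator I K)" if g: "g \<in> carrier G" for g
  proof -
    have "bij_betw (?R g) (e ` annihilator I K) (e ` annihilator I K)"
    proof (rule bij_betw_byWitness[where f' = "?R (inv\<^bsub>G\<^esub> g)"])
      show "\<forall>x\<in>e ` annihilator I K. ?R (inv\<^bsub>G\<^esub> g) (?R g x) = x"
        by (intro ballI, subst RR) (use g R1 in auto)
      show "\<forall>x\<in>e ` annihilator I K. ?R g (?R (inv\<^bsub>G\<^esub> g) x) = x"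
        by (intro ballI, subst RR) (use g R1 in auto)
    qed (use g RC in blast)+
    then show ?thesis by (simp add: Bij_def)
  qed
  have act: "group_action G (carrier ?V) ?R"
  proof (unfold group_action_def, intro group_hom.intro G group_BijGroup group_hom_axioms.intro homI)
    fix g h assume gh: "g \<in> carrier G" "h \<in> carrier G"
    show "?R g \<in> carrier (BijGroup (carrier ?V))"
      using Bij[OF gh(1)] by (simp add: BijGroup_def coord_space_simps)
    have "?R (g \<otimes>\<^bsub>G\<^esub> h) = compose (e ` annihilator I K) (?R g) (?R h)"
    proof (rule extensionalityI)
      fix x assume x: "x \<in> e ` annihilator I K"
      show "?R (g \<otimes>\<^bsub>G\<^esub> h) x = compose (e ` annihilator I K) (?R g) (?R h) x"
        using RR[OF gh x] x by (simp only: compose_eq)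
    qed auto
    then show "?R (g \<otimes>\<^bsub>G\<^esub> h) = ?R g \<otimes>\<^bsub>BijGroup (carrier ?V)\<^esub> ?R h"
      using Bij gh by (simp add: BijGroup_def coord_space_simps)
  qed
  show ?thesis
  proof (intro unitary_rep.intro act coord_space_hilbert unitary_rep_axioms.intro)
    fix g x y assume g: "g \<in> carrier G" and "x \<in> carrier ?V" "y \<in> carrier ?V"
    then obtain f h where f: "f \<in> annihilator I K" "x = e f" and h: "h \<in> annihilator I K" "y = e h"
      by (auto simp: coord_space_simps)
    show "?R g (x \<oplus>\<^bsub>?V\<^esub> y) = ?R g x \<oplus>\<^bsub>?V\<^esub> ?R g y"
      unfolding f(2) h(2) coord_space_simps R[OF f(1)] R[OF h(1)] R[OF annihilator_add[OF f(1) h(1)]]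
      by (simp add: comp_def)
    have "(\<Sum>k\<in>I. f (\<pi> g k) * cnj (h (\<pi> g k))) = (\<Sum>k\<in>I. f k * cnj (h k))"
      using bij[OF g] by (rule sum.reindex_bij_betw)
    then show "ip ?V (?R g x) (?R g y) = ip ?V x y"
      unfolding f(2) h(2) coord_space_simps R[OF f(1)] R[OF h(1)] by simp
  next
    fix g x a assume g: "g \<in> carrier G" and "x \<in> carrier ?V"
    then obtain f where f: "f \<in> annihilator I K" "x = e f" by (auto simp: coord_space_simps)
    show "?R g (a \<odot>\<^bsub>?V\<^esub> x) = a \<odot>\<^bsub>?V\<^esub> ?R g x"
      unfolding f(2) coord_space_simps R[OF f(1)] R[OF annihilator_scale[OF f(1)]]
      by (simp add: comp_def)
  qed (fact \<open>finite I\<close>)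
qed

end

section \<open>A representation attaining the bound\<close>

text \<open>
  A matrix is orthogonal to the indicator functions of all columns if and only if its column sums
  vanish. Such matrices, with $S_n$ permuting the rows, form a direct sum of $n$ copies of $D'$.
\<close>

definition column :: "nat \<Rightarrow> nat \<times> nat \<Rightarrow> complex" where
  "column c = (\<lambda>(i, j). if j = c then 1 else 0)"

abbreviation cells :: "nat \<Rightarrow> (nat \<times> nat) set" where
  "cells n \<equiv> {1..n} \<times> {1..n}"

lemma mem_annihilator_columns:
  "f \<in> annihilator (cells n) (column ` {1..n}) \<longleftrightarrow>
    (\<forall>k. k \<notin> cells n \<longrightarrow> f k = 0) \<and> (\<forall>c\<in>{1..n}. (\<Sum>i=1..n. f (i, c)) = 0)"
proof -
  have "(\<Sum>k\<in>cells n. f k * cnj (column c k)) = (\<Sum>i=1..n. f (i, c))" if "c \<in> {1..n}" for c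
  proof -
    have "(\<Sum>k\<in>cells n. f k * cnj (column c k))
        = (\<Sum>i=1..n. \<Sum>j=1..n. if j = c then f (i, j) else 0)"
      unfolding sum.cartesian_product by (auto simp: column_def intro!: sum.cong)
    also have "\<dots> = (\<Sum>i=1..n. f (i, c))" using that by simp
    finally show ?thesis .
  qed
  then show ?thesis by (simp add: annihilator_def)
qed

text \<open>
  The rows are the vertices $e_i - \frac1n \sum_k e_k$ of a regular simplex centred at 0, and
  $\sqrt{n-1}$ is the norm of the matrix that they form.
\<close>

definition simplex_matrix :: "nat \<Rightarrow> nat \<times> nat \<Rightarrow> complex" where
  "simplex_matrix n = (\<lambda>(i, j). if (i, j) \<in> cells n
     then of_real ((of_bool (i = j) - 1 / real n) / sqrt (real n - 1)) else 0)"

lemma simplex_matrix_mem: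
  assumes n: "n \<ge> 2"
  shows "simplex_matrix n \<in> annihilator (cells n) (column ` {1..n})"
proof -
  have "(\<Sum>i=1..n. simplex_matrix n (i, c)) = 0" if c: "c \<in> {1..n}" for c
  proof -
    have "(\<Sum>i=1..n. simplex_matrix n (i, c))
        = of_real (\<Sum>i=1..n. (of_bool (i = c) - 1 / real n) / sqrt (real n - 1))"
      unfolding of_real_sum using c by (intro sum.cong) (auto simp: simplex_matrix_def)
    also have "(\<Sum>i=1..n. (of_bool (i = c) - 1 / real n) / sqrt (real n - 1))
        = ((\<Sum>i=1..n. of_bool (i = c)) - (\<Sum>i=1..n. 1 / real n)) / sqrt (real n - 1)"
      by (simp only: sum_divide_distrib[symmetric] sum_subtractf)
    also have "\<dots> = 0" using c n by (simp add: of_bool_def)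
    finally show ?thesis by simp
  qed
  then show ?thesis by (auto simp: mem_annihilator_columns simplex_matrix_def)
qed

lemma sum_simplex_matrix:
  assumes n: "n \<ge> 2"
  shows "(\<Sum>k\<in>cells n. (cmod (simplex_matrix n k))\<^sup>2) = 1"
proof -
  have "(\<Sum>k\<in>cells n. (cmod (simplex_matrix n k))\<^sup>2)
      = (\<Sum>i=1..n. \<Sum>j=1..n. (of_bool (i = j) - 1 / real n)\<^sup>2 / (real n - 1))"
    unfolding sum.cartesian_product using n
    by (intro sum.cong) (auto simp: simplex_matrix_def norm_divide power_divide simp del: of_real_divide)
  also have "\<dots> = (\<Sum>i=1..n. (1 - 1 / real n) / (real n - 1))"
  proof (rule sum.cong[OF refl])
    fix i assume i: "i \<in> {1..n}"
    have "(\<Sum>j=1..n. (of_bool (i = j) - 1 / real n)\<^sup>2)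
        = (\<Sum>j=1..n. of_bool (i = j) * (1 - 2 / real n) + 1 / (real n)\<^sup>2)"
      by (intro sum.cong refl) (simp add: of_bool_def power2_diff power_divide)
    also have "\<dots> = 1 - 1 / real n"
      using i n by (simp add: sum.distrib of_bool_def if_distrib[of "\<lambda>x. x * _"] power2_eq_square cong: if_cong)
    finally show "(\<Sum>j=1..n. (of_bool (i = j) - 1 / real n)\<^sup>2 / (real n - 1)) = (1 - 1 / real n) / (real n - 1)"
      by (simp flip: sum_divide_distrib)
  qed
  also have "\<dots> = (real n - 1) / (real n - 1)" using n by (simp add: right_diff_distrib)
  finally show ?thesis using n by simp
qed

text \<open>
  Exchanging the rows $a$ and $b$ changes each of these two rows by
  $\pm (e_a - e_b) / \sqrt{n-1}$.
\<close>

lemma sum_simplex_matrix_displacement: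
  assumes n: "n \<ge> 2" and ab: "a \<in> {1..n}" "b \<in> {1..n}" "a \<noteq> b"
  shows "(\<Sum>k\<in>cells n. (cmod (simplex_matrix n (map_prod (transpose a b) id k) - simplex_matrix n k))\<^sup>2)
    = 4 / (real n - 1)"
proof -
  let ?t = "transpose a b"
  have perm: "?t permutes {1..n}" using ab by (intro permutes_swap_id)
  have "(\<Sum>k\<in>cells n. (cmod (simplex_matrix n (map_prod ?t id k) - simplex_matrix n k))\<^sup>2)
      = (\<Sum>i=1..n. \<Sum>j=1..n. (of_bool (?t i = j) - of_bool (i = j))\<^sup>2 / (real n - 1))"
    unfolding sum.cartesian_product
  proof (intro sum.cong refl, clarify)
    fix i j assume ij: "i \<in> {1..n}" "j \<in> {1..n}"
    then have "?t i \<in> {1..n}" using permutes_in_image[OF perm] by blast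
    then have "simplex_matrix n (map_prod ?t id (i, j)) - simplex_matrix n (i, j)
        = of_real ((of_bool (?t i = j) - of_bool (i = j)) / sqrt (real n - 1))"
      using ij by (simp add: simplex_matrix_def diff_divide_distrib)
    then show "(cmod (simplex_matrix n (map_prod ?t id (i, j)) - simplex_matrix n (i, j)))\<^sup>2
        = (of_bool (?t i = j) - of_bool (i = j))\<^sup>2 / (real n - 1)"
      using n by (simp only: norm_of_real power2_abs power_divide) simp
  qed
  also have "\<dots> = (\<Sum>i=1..n. (if i \<in> {a, b} then 2 else 0) / (real n - 1))"
  proof (rule sum.cong[OF refl])
    fix i assume i: "i \<in> {1..n}"
    have ti: "?t i \<in> {1..n}" using permutes_in_image[OF perm] i by blast
    have "(\<Sum>j=1..n. (of_bool (?t i = j) - of_bool (i = j) :: real)\<^sup>2) = (if i \<in> {a, b} then 2 else 0)"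
    proof (cases "i \<in> {a, b}")
      case True
      then have "?t i \<noteq> i" using ab by (auto simp: transpose_def)
      then have "(\<Sum>j=1..n. (of_bool (?t i = j) - of_bool (i = j) :: real)\<^sup>2)
          = (\<Sum>j=1..n. of_bool (?t i = j) + of_bool (i = j))"
        by (intro sum.cong refl) (auto simp: of_bool_def)
      then show ?thesis using True i ti by (simp add: sum.distrib of_bool_def)
    next
      case False
      then have "?t i = i" by (auto simp: transpose_def)
      then show ?thesis using False by simp
    qed
    then show "(\<Sum>j=1..n. (of_bool (?t i = j) - of_bool (i = j))\<^sup>2 / (real n - 1))
        = (if i \<in> {a, b} then 2 else 0) / (real n - 1)"
      by (simp flip: sum_divide_distrib)
  qed
  also have "\<dots> = (\<Sum>i\<in>{1..n}. if i \<in> {a, b} then 2 else 0) / (real n - 1)"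
    by (rule sum_divide_distrib[symmetric])
  also have "(\<Sum>i\<in>{1..n}. if i \<in> {a, b} then 2 else 0) = (\<Sum>i\<in>{a, b}. 2 :: real)"
    using ab by (intro sum.mono_neutral_cong_right) auto
  also have "\<dots> = 4" using ab by simp
  finally show ?thesis .
qed

text \<open>
  A matrix fixed by all permutations of its rows has constant columns, and a constant column whose
  sum is 0 vanishes.
\<close>

lemma matrix_rep_nontrivial:
  fixes e :: "(nat \<times> nat \<Rightarrow> complex) \<Rightarrow> 'v"
  assumes inj: "inj e" and n: "n \<ge> 2"
  defines "V \<equiv> coord_space e (cells n) (column ` {1..n})"
    and "R \<equiv> \<lambda>p. \<lambda>x\<in>e ` annihilator (cells n) (column ` {1..n}). e (inv' e x \<circ> map_prod (inv' p) id)"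
  shows "(V, R) \<in> nontrivial_reps (sym_group n)"
proof -
  let ?C = "annihilator (cells n) (column ` {1..n})"
  have closed: "f \<circ> map_prod (inv' p) id \<in> ?C" if p: "p permutes {1..n}" and f: "f \<in> ?C" for p f
  proof -
    have p': "inv' p permutes {1..n}" using p by (rule permutes_inv)
    have "(\<Sum>i=1..n. f (inv' p i, c)) = (\<Sum>i=1..n. f (i, c))" for c
      using sum.permute[OF p', of "\<lambda>i. f (i, c)"] by (simp add: comp_def)
    then show ?thesis
      using f permutes_in_image[OF p'] unfolding mem_annihilator_columns by auto
  qed
  have rep: "unitary_rep (sym_group n) V R"
    unfolding V_def R_def
  proof (rule coord_space_unitary_rep[OF inj])
    fix p q assume "p \<in> carrier (sym_group n)" "q \<in> carrier (sym_group n)"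
    then have "inv' (p \<circ> q) = inv' q \<circ> inv' p"
      by (intro o_inv_distrib) (auto simp: sym_group_carrier intro: permutes_bij)
    then show "map_prod (inv' (p \<otimes>\<^bsub>sym_group n\<^esub> q)) id = map_prod (inv' q) id \<circ> map_prod (inv' p) id"
      by (simp add: sym_group_mult map_prod.comp)
  next
    fix p assume "p \<in> carrier (sym_group n)"
    then have "bij_betw (inv' p) {1..n} {1..n}"
      by (auto simp: sym_group_carrier intro!: permutes_imp_bij permutes_inv)
    then show "bij_betw (map_prod (inv' p) id) (cells n) (cells n)"
      by (intro bij_betw_map_prod) auto
  qed (auto simp: sym_group_is_group sym_group_one sym_group_carrier closed map_prod.id)
  have mem: "e (simplex_matrix n) \<in> carrier V"
    using simplex_matrix_mem[OF n] by (simp add: V_def coord_space_simps[OF inj])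
  have "simplex_matrix n \<noteq> (\<lambda>_. 0)"
    using sum_simplex_matrix[OF n] by (auto simp: power2_eq_square)
  then have "e (simplex_matrix n) \<noteq> \<zero>\<^bsub>V\<^esub>"
    using inj by (simp add: V_def coord_space_simps[OF inj] inj_eq)
  moreover have "x = \<zero>\<^bsub>V\<^esub>" if x: "x \<in> carrier V" and fixed: "\<forall>p\<in>carrier (sym_group n). R p x = x" for x
  proof -
    obtain f where f: "f \<in> ?C" "x = e f" using x by (auto simp: V_def coord_space_simps[OF inj])
    have const: "f (i, c) = f (1, c)" if i: "i \<in> {1..n}" for i c
    proof -
      have t: "transpose 1 i \<in> carrier (sym_group n)"
        using i n by (auto simp: sym_group_carrier intro!: permutes_swap_id)
      have "e (f \<circ> map_prod (transpose 1 i) id) = e f"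
        using fixed[rule_format, OF t] f by (simp add: R_def inv_f_f[OF inj])
      then have "f \<circ> map_prod (transpose 1 i) id = f" using inj by (simp add: inj_eq)
      from fun_cong[OF this, of "(1, c)"] show ?thesis by simp
    qed
    have "f (i, c) = 0" if "i \<in> {1..n}" "c \<in> {1..n}" for i c
    proof -
      have "0 = (\<Sum>i=1..n. f (i, c))" using f(1) that by (simp add: mem_annihilator_columns)
      also have "\<dots> = (\<Sum>i=1..n. f (1, c))" by (intro sum.cong refl const)
      finally have "f (1, c) = 0" using n by simp
      then show ?thesis unfolding const[OF that(1)] .
    qed
    moreover have "f k = 0" if "k \<notin> cells n" for k
      using f(1) that unfolding mem_annihilator_columns by blast
    ultimately have "f k = 0" for k by (cases k) blast
    then have "f = (\<lambda>_. 0)" by (simp add: fun_eq_iff)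
    then show ?thesis by (simp add: f V_def coord_space_simps[OF inj])
  qed
  ultimately show ?thesis using rep mem unfolding nontrivial_reps_def by blast
qed

lemma exists_rep_kazhdan_const_le:
  fixes emb :: "(nat \<Rightarrow> complex) \<Rightarrow> 'v"
  assumes inj: "inj emb" and n: "n \<ge> 2"
  shows "\<exists>VR \<in> (nontrivial_reps (sym_group n) :: ('v hilbert \<times> ((nat \<Rightarrow> nat) \<Rightarrow> 'v \<Rightarrow> 'v)) set).
    kazhdan_const_rep (transpositions n) VR \<le> 2 / sqrt (real n - 1)"
proof -
  \<comment> \<open>Matrices are encoded as sequences, because \<open>emb\<close> accepts functions of one natural number.\<close>
  define e where "e = (\<lambda>f. emb (f \<circ> prod_decode))"
  have inj_e: "inj e"
  proof (rule injI)
    fix f g assume "e f = e g"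
    then have "f \<circ> prod_decode = g \<circ> prod_decode" using inj by (simp add: e_def inj_eq)
    then have "f (prod_decode (prod_encode k)) = g (prod_decode (prod_encode k))" for k
      by (metis comp_apply)
    then show "f = g" by (simp add: fun_eq_iff)
  qed
  define V where "V = coord_space e (cells n) (column ` {1..n})"
  define R where "R = (\<lambda>p. \<lambda>x\<in>e ` annihilator (cells n) (column ` {1..n}). e (inv' e x \<circ> map_prod (inv' p) id))"
  have VR: "(V, R) \<in> nontrivial_reps (sym_group n)"
    unfolding V_def R_def by (rule matrix_rep_nontrivial[OF inj_e n])
  interpret unitary_rep "sym_group n" V R using VR by (simp add: nontrivial_reps_def)
  let ?v = "e (simplex_matrix n)"
  have mem: "?v \<in> carrier V"
    using simplex_matrix_mem[OF n] by (simp add: V_def coord_space_simps[OF inj_e])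
  have unit: "hnorm V ?v = 1"
    by (simp add: V_def hnorm_coord_space[OF inj_e] sum_simplex_matrix[OF n])
  have displ: "hnorm V (R q ?v \<ominus>\<^bsub>V\<^esub> ?v) = 2 / sqrt (real n - 1)" if q: "q \<in> transpositions n" for q
  proof -
    obtain a b where ab: "a \<in> {1..n}" "b \<in> {1..n}" "a \<noteq> b" and q': "q = transpose a b"
      using q by (auto simp: transpositions_def)
    have Rq: "R q ?v = e (simplex_matrix n \<circ> map_prod (transpose a b) id)"
      using simplex_matrix_mem[OF n] by (simp add: R_def q' inv_f_f[OF inj_e])
    have "q \<in> carrier (sym_group n)" using q transpositions_subset by (auto simp: sym_group_carrier)
    then have "R q ?v \<in> carrier V" using mem element_image by blast
    then have "simplex_matrix n \<circ> map_prod (transpose a b) id \<in> annihilator (cells n) (column ` {1..n})"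
      unfolding Rq by (auto simp: V_def coord_space_simps[OF inj_e] inj_eq[OF inj_e])
    then have "R q ?v \<ominus>\<^bsub>V\<^esub> ?v
        = e (\<lambda>k. simplex_matrix n (map_prod (transpose a b) id k) - simplex_matrix n k)"
      unfolding Rq V_def by (subst coord_space_diff[OF inj_e _ simplex_matrix_mem[OF n]]) simp_all
    then show ?thesis
      by (simp add: V_def hnorm_coord_space[OF inj_e] sum_simplex_matrix_displacement[OF n ab] real_sqrt_divide)
  qed
  have "kazhdan_const_rep (transpositions n) (V, R)
      \<le> (MAX q\<in>transpositions n. hnorm V (R q ?v \<ominus>\<^bsub>V\<^esub> ?v))"
    by (rule kazhdan_const_rep_transpositions_le[OF n VR mem unit])
  also have "(\<lambda>q. hnorm V (R q ?v \<ominus>\<^bsub>V\<^esub> ?v)) ` transpositions n = {2 / sqrt (real n - 1)}"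
    using displ transpositions_nonempty[OF n] by auto
  finally show ?thesis using VR by auto
qed

lemma kazhdan_const_transpositions:
  fixes emb :: "(nat \<Rightarrow> complex) \<Rightarrow> 'v"
  assumes "inj emb" and n: "n \<ge> 2"
  shows "kazhdan_const TYPE('v) (sym_group n) (transpositions n) = 2 / sqrt (real n - 1)"
proof -
  obtain VR :: "'v hilbert \<times> ((nat \<Rightarrow> nat) \<Rightarrow> 'v \<Rightarrow> 'v)"
    where VR: "VR \<in> nontrivial_reps (sym_group n)"
      and le: "kazhdan_const_rep (transpositions n) VR \<le> 2 / sqrt (real n - 1)"
    using exists_rep_kazhdan_const_le[OF assms] by blast
  show ?thesis
  proof (rule antisym)
    have "bdd_below (kazhdan_const_rep (transpositions n) `
        (nontrivial_reps (sym_group n) :: ('v hilbert \<times> ((nat \<Rightarrow> nat) \<Rightarrow> 'v \<Rightarrow> 'v)) set))"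
      using kazhdan_const_rep_transpositions_ge[OF n] by (rule bdd_belowI2)
    from cINF_lower2[OF this VR le]
    show "kazhdan_const TYPE('v) (sym_group n) (transpositions n) \<le> 2 / sqrt (real n - 1)"
      unfolding kazhdan_const_def .
    show "2 / sqrt (real n - 1) \<le> kazhdan_const TYPE('v) (sym_group n) (transpositions n)"
      unfolding kazhdan_const_def using VR
      by (intro cINF_greatest kazhdan_const_rep_transpositions_ge[OF n]) auto
  qed
qed

section \<open>Distances between points of the plane\<close>

text \<open>
  Put $s_k = |x_k|^2$ and $P_{kl} = \mathrm{Re}(x_k \overline{x_l})$, the Gram matrix of the points. Then
  $|x_k - x_l|^4 = (s_k + s_l - 2P_{kl})^2 \ge 4 s_k s_l + 4 P_{kl}^2 - 4 (s_k + s_l) P_{kl}$. In the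
  sum the last term vanishes, because the rows and columns of $P$ add up to 0. The matrix $P$ has
  rank at most 2, so $\sum_{k,l} P_{kl}^2 \ge \frac12 (\mathrm{tr} P)^2$, where $\mathrm{tr} P = \sum_k s_k$.
\<close>

lemma sum_power4_differences_ge:
  fixes x :: "'i \<Rightarrow> complex"
  assumes zero: "(\<Sum>k\<in>I. x k) = 0"
  shows "6 * (\<Sum>k\<in>I. (cmod (x k))\<^sup>2)\<^sup>2 \<le> (\<Sum>k\<in>I. \<Sum>l\<in>I. ((cmod (x k - x l))\<^sup>2)\<^sup>2)"
proof -
  define a b where "a k = Re (x k)" and "b k = Im (x k)" for k
  define s where "s k = (a k)\<^sup>2 + (b k)\<^sup>2" for k
  define A B C where "A = (\<Sum>k\<in>I. (a k)\<^sup>2)" and "B = (\<Sum>k\<in>I. (b k)\<^sup>2)" and "C = (\<Sum>k\<in>I. a k * b k)"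
  have S: "(\<Sum>k\<in>I. s k) = A + B" by (simp add: s_def A_def B_def sum.distrib)
  have a0: "(\<Sum>k\<in>I. a k) = 0" and b0: "(\<Sum>k\<in>I. b k) = 0"
    using arg_cong[OF zero, of Re] arg_cong[OF zero, of Im] by (simp_all add: a_def b_def)
  have "(\<Sum>k\<in>I. \<Sum>l\<in>I. 4 * (s k * s l) + 4 * ((a k)\<^sup>2 * (a l)\<^sup>2 + (b k)\<^sup>2 * (b l)\<^sup>2
            + 2 * ((a k * b k) * (a l * b l)))
          - 4 * ((s k * a k) * a l + (s k * b k) * b l + a k * (s l * a l) + b k * (s l * b l)))
      \<le> (\<Sum>k\<in>I. \<Sum>l\<in>I. ((cmod (x k - x l))\<^sup>2)\<^sup>2)"
  proof (intro sum_mono)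
    fix k l
    let ?P = "a k * a l + b k * b l"
    have "((cmod (x k - x l))\<^sup>2)\<^sup>2 = (s k + s l - 2 * ?P)\<^sup>2"
      by (simp add: cmod_power2 s_def a_def b_def) (simp add: power2_eq_square algebra_simps)
    also have "\<dots> = (s k - s l)\<^sup>2 + (4 * (s k * s l) + 4 * ?P\<^sup>2 - 4 * ((s k + s l) * ?P))"
      by (simp add: power2_eq_square algebra_simps)
    also have "\<dots> \<ge> 4 * (s k * s l) + 4 * ?P\<^sup>2 - 4 * ((s k + s l) * ?P)" by simp
    finally show "4 * (s k * s l) + 4 * ((a k)\<^sup>2 * (a l)\<^sup>2 + (b k)\<^sup>2 * (b l)\<^sup>2
            + 2 * ((a k * b k) * (a l * b l)))
          - 4 * ((s k * a k) * a l + (s k * b k) * b l + a k * (s l * a l) + b k * (s l * b l))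
        \<le> ((cmod (x k - x l))\<^sup>2)\<^sup>2"
      by (simp add: power2_eq_square algebra_simps)
  qed
  also have "(\<Sum>k\<in>I. \<Sum>l\<in>I. 4 * (s k * s l) + 4 * ((a k)\<^sup>2 * (a l)\<^sup>2 + (b k)\<^sup>2 * (b l)\<^sup>2
            + 2 * ((a k * b k) * (a l * b l)))
          - 4 * ((s k * a k) * a l + (s k * b k) * b l + a k * (s l * a l) + b k * (s l * b l)))
      = 4 * ((A + B) * (A + B)) + 4 * (A * A + B * B + 2 * (C * C))"
    unfolding sum_subtractf sum.distrib sum_distrib_left[symmetric] sum_distrib_right[symmetric] a0 b0 S
      A_def[symmetric] B_def[symmetric] C_def[symmetric] by simp
  finally have le: "4 * ((A + B) * (A + B)) + 4 * (A * A + B * B + 2 * (C * C))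
      \<le> (\<Sum>k\<in>I. \<Sum>l\<in>I. ((cmod (x k - x l))\<^sup>2)\<^sup>2)" .
  have "(\<Sum>k\<in>I. (cmod (x k))\<^sup>2) = A + B"
    by (simp add: cmod_power2 A_def B_def a_def b_def sum.distrib)
  moreover have "6 * (A + B)\<^sup>2 \<le> 4 * ((A + B) * (A + B)) + 4 * (A * A + B * B + 2 * (C * C))"
  proof -
    have "4 * ((A + B) * (A + B)) + 4 * (A * A + B * B + 2 * (C * C)) - 6 * (A + B)\<^sup>2
        = 2 * (A - B)\<^sup>2 + 8 * C\<^sup>2"
      by (simp add: power2_eq_square algebra_simps)
    also have "\<dots> \<ge> 0" by simp
    finally show ?thesis by simp
  qed
  ultimately show ?thesis using le by simp
qed

lemma sum_power2_differences:
  fixes x :: "'i \<Rightarrow> complex"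
  assumes zero: "(\<Sum>k\<in>I. x k) = 0"
  shows "(\<Sum>k\<in>I. \<Sum>l\<in>I. (cmod (x k - x l))\<^sup>2) = 2 * real (card I) * (\<Sum>k\<in>I. (cmod (x k))\<^sup>2)"
proof -
  define a b where "a k = Re (x k)" and "b k = Im (x k)" for k
  have a0: "(\<Sum>k\<in>I. a k) = 0" and b0: "(\<Sum>k\<in>I. b k) = 0"
    using arg_cong[OF zero, of Re] arg_cong[OF zero, of Im] by (simp_all add: a_def b_def)
  have "(\<Sum>k\<in>I. \<Sum>l\<in>I. (cmod (x k - x l))\<^sup>2)
      = (\<Sum>k\<in>I. \<Sum>l\<in>I. (cmod (x k))\<^sup>2 + (cmod (x l))\<^sup>2 - 2 * (a k * a l) - 2 * (b k * b l))"
    by (simp add: cmod_power2 a_def b_def) (simp add: power2_eq_square algebra_simps)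
  also have "\<dots> = (\<Sum>k\<in>I. \<Sum>l\<in>I. (cmod (x k))\<^sup>2) + (\<Sum>k\<in>I. \<Sum>l\<in>I. (cmod (x l))\<^sup>2)"
    unfolding sum_subtractf sum.distrib sum_distrib_left[symmetric] sum_distrib_right[symmetric] a0 b0 by simp
  finally show ?thesis by (simp add: flip: sum_distrib_left)
qed

section \<open>The Kazhdan constant of the standard representation\<close>

lemma std_space_eq:
  "std_space n = coord_space id {1..n} {\<lambda>i. \<Sum>k=1..n. basis_vec k i}"
  by (simp add: std_space_def complex_space_def coord_space_def annihilator_def)

lemma sum_basis_vec: "i \<in> {1..n} \<Longrightarrow> (\<Sum>k=1..n. basis_vec k i) = 1"
  by (simp add: basis_vec_def)

lemma std_space_carrier:
  "carrier (std_space n) = {f. (\<forall>k. k \<notin> {1..n} \<longrightarrow> f k = 0) \<and> (\<Sum>k=1..n. f k) = 0}"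
proof -
  have "(\<Sum>k=1..n. f k * cnj (\<Sum>l=1..n. basis_vec l k)) = (\<Sum>k=1..n. f k)" for f
    by (intro sum.cong refl, subst sum_basis_vec) auto
  then show ?thesis
    unfolding std_space_eq coord_space_simps(1)[OF inj_on_id] annihilator_def by (simp del: cnj_sum)
qed

lemma std_displacement:
  assumes v: "v \<in> carrier (std_space n)" and ij: "i \<in> {1..n}" "j \<in> {1..n}" "i \<noteq> j"
  shows "hnorm (std_space n) (snd (std_rep n) (transpose i j) v \<ominus>\<^bsub>std_space n\<^esub> v)
    = sqrt (2 * (cmod (v i - v j))\<^sup>2)"
proof -
  let ?t = "transpose i j"
  let ?K = "{\<lambda>i. \<Sum>k=1..n. basis_vec k i}"
  have mem: "f \<in> annihilator {1..n} ?K \<longleftrightarrow> f \<in> carrier (std_space n)" for f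
    unfolding std_space_eq coord_space_simps(1)[OF inj_on_id] by simp
  have perm: "?t permutes {1..n}" using ij by (intro permutes_swap_id)
  have vt: "v \<circ> ?t \<in> carrier (std_space n)"
    using v sum.permute[OF perm, of v] permutes_in_image[OF perm]
    by (auto simp: std_space_carrier comp_def)
  have "snd (std_rep n) ?t v = v \<circ> ?t" using v by (simp add: std_rep_def perm_op_def)
  moreover have "(v \<circ> ?t) \<ominus>\<^bsub>std_space n\<^esub> v = (\<lambda>k. v (?t k) - v k)"
    using coord_space_diff[OF inj_on_id, of "v \<circ> ?t" "{1..n}" ?K v] v vt mem
    unfolding std_space_eq by (simp add: comp_def)
  moreover have "(\<Sum>k=1..n. (cmod (v (?t k) - v k))\<^sup>2) = 2 * (cmod (v i - v j))\<^sup>2"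
  proof -
    have "(\<Sum>k=1..n. (cmod (v (?t k) - v k))\<^sup>2) = (\<Sum>k\<in>{i, j}. (cmod (v (?t k) - v k))\<^sup>2)"
      using ij by (intro sum.mono_neutral_right) (auto simp: transpose_def)
    then show ?thesis using ij(3) by (simp add: norm_minus_commute)
  qed
  ultimately show ?thesis
    using hnorm_coord_space[OF inj_on_id, of "{1..n}" ?K] unfolding std_space_eq by simp
qed

text \<open>
  If all $|x_k - x_l|^2$ are at most $B$, then
  $6 \le \sum_{k,l} |x_k - x_l|^4 \le B \sum_{k,l} |x_k - x_l|^2 = 2nB$, and the transposition $(k\,l)$
  moves $x$ by $\sqrt2\, |x_k - x_l|$.
\<close>

lemma std_max_displacement_ge:
  assumes n: "n \<ge> 2" and v: "v \<in> carrier (std_space n)" and unit: "hnorm (std_space n) v = 1"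
  shows "sqrt (6 / real n)
    \<le> (MAX q\<in>transpositions n. hnorm (std_space n) (snd (std_rep n) q v \<ominus>\<^bsub>std_space n\<^esub> v))"
proof -
  define M where "M = (MAX q\<in>transpositions n. hnorm (std_space n) (snd (std_rep n) q v \<ominus>\<^bsub>std_space n\<^esub> v))"
  have zero: "(\<Sum>k=1..n. v k) = 0" using v by (simp add: std_space_carrier)
  have norm1: "(\<Sum>k=1..n. (cmod (v k))\<^sup>2) = 1"
    using unit hnorm_coord_space[OF inj_on_id, of "{1..n}" "{\<lambda>i. \<Sum>k=1..n. basis_vec k i}" v]
    unfolding std_space_eq by simp
  have M: "sqrt (2 * (cmod (v i - v j))\<^sup>2) \<le> M" if "i \<in> {1..n}" "j \<in> {1..n}" "i \<noteq> j" for i j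
    unfolding M_def std_displacement[OF v that, symmetric] using that by (rule displacement_le_Max)
  have "(1::nat) \<in> {1..n}" "(2::nat) \<in> {1..n}" "(1::nat) \<noteq> 2" using n by auto
  from M[OF this] have M0: "M \<ge> 0" by (rule order_trans[rotated]) simp
  have d: "(cmod (v i - v j))\<^sup>2 \<le> M\<^sup>2 / 2" if "i \<in> {1..n}" "j \<in> {1..n}" for i j
  proof (cases "i = j")
    case False
    from sqrt_le_D[OF M[OF that this]] show ?thesis by simp
  qed simp
  have "6 \<le> (\<Sum>k=1..n. \<Sum>l=1..n. ((cmod (v k - v l))\<^sup>2)\<^sup>2)"
    using sum_power4_differences_ge[OF zero] by (simp add: norm1)
  also have "\<dots> \<le> (\<Sum>k=1..n. \<Sum>l=1..n. M\<^sup>2 / 2 * (cmod (v k - v l))\<^sup>2)"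
    unfolding power2_eq_square[of "(cmod _)\<^sup>2"] by (intro sum_mono mult_right_mono d) auto
  also have "\<dots> = M\<^sup>2 / 2 * (\<Sum>k=1..n. \<Sum>l=1..n. (cmod (v k - v l))\<^sup>2)"
    by (simp only: sum_distrib_left)
  also have "\<dots> = M\<^sup>2 * real n"
    using sum_power2_differences[OF zero] by (simp add: norm1)
  finally have "6 / real n \<le> M\<^sup>2" using n by (simp add: pos_divide_le_eq)
  then have "sqrt (6 / real n) \<le> M" using M0 by (intro real_le_lsqrt) auto
  then show ?thesis by (simp add: M_def)
qed

lemma kazhdan_const_rep_std_ge:
  assumes n: "n \<ge> 2"
  shows "sqrt (6 / real n) \<le> kazhdan_const_rep (transpositions n) (std_rep n)"
proof -
  interpret hilbert_space "std_space n"
    unfolding std_space_eq by (intro coord_space_hilbert) auto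
  \<comment> \<open>The vector $e_1 - e_2$ shows that the infimum is not over the empty set.\<close>
  let ?f = "\<lambda>k::nat. if k = 1 then 1 else if k = 2 then -1 else 0 :: complex"
  have sub: "{1, 2} \<subseteq> {1..n}" using n by auto
  have "(\<Sum>k=1..n. ?f k) = (\<Sum>k\<in>{1, 2}. ?f k)"
    using sub by (intro sum.mono_neutral_right) auto
  then have "?f \<in> carrier (std_space n)" using sub by (auto simp: std_space_carrier)
  moreover have "?f \<noteq> \<zero>\<^bsub>std_space n\<^esub>"
    unfolding std_space_eq coord_space_simps(2)[OF inj_on_id] by (auto simp: fun_eq_iff)
  ultimately have "{v \<in> carrier (std_space n). hnorm (std_space n) v = 1} \<noteq> {}"
    using exists_unit_vector by blast
  then show ?thesis
    using std_max_displacement_ge[OF n]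
    unfolding kazhdan_const_rep_def std_rep_def by (auto intro!: cINF_greatest)
qed

section \<open>Comparison of the two constants\<close>

theorem proposition5p2:
  fixes n :: nat and emb :: "(nat \<Rightarrow> complex) \<Rightarrow> 'v"
  assumes "n \<ge> 4"
    and "inj emb"
  shows "kazhdan_const_rep (transpositions n) (std_rep n)
           > kazhdan_const TYPE('v) (sym_group n) (transpositions n)
       \<and> kazhdan_const TYPE('v) (sym_group n) (transpositions n) = 2 / sqrt (real n - 1)"
proof -
  have eq: "kazhdan_const TYPE('v) (sym_group n) (transpositions n) = 2 / sqrt (real n - 1)"
    using assms by (intro kazhdan_const_transpositions) auto
  have "2 / sqrt (real n - 1) = sqrt (4 / (real n - 1))" by (simp add: real_sqrt_divide)
  also have "\<dots> < sqrt (6 / real n)" using assms(1) by (simp add: field_simps)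
  also have "\<dots> \<le> kazhdan_const_rep (transpositions n) (std_rep n)"
    using assms(1) by (intro kazhdan_const_rep_std_ge) simp
  finally show ?thesis using eq by simp
qed

end
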